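(* Let $(V,\omega)$ be a symplectic vector space of dimension $2n$ and let $U\subset V$ be a Lagrangian subspace. The assignment $H\mapsto S^H$ (described in the context) induces a one-to-one correspondence between Abelian simply transitive affine groups $H$ of symplectic type on $V$, up to conjugation in the affine symplectic group $\mathrm{Aff}_{\mathrm{Sp}(V)}(V)$, and elements of $S^3U$ up to $\mathrm{Sp}(V)$-equivalence, where two elements of $S^3U\subset S^3V$ are called $\mathrm{Sp}(V)$-equivalent if they lie on the same $\mathrm{Sp}(V)$-orbit in $S^3V$.
   Context: $V$ is a finite-dimensional real vector space with a nondegenerate alternating form $\omega$; $\mathrm{Sp}(V)$ is its symplectic group, $\mathfrak{sp}(V)$ the Lie algebra. A Lagrangian subspace is a maximal $\omega$-isotropic subspace. $\mathrm{Aff}_{\mathrm{Sp}(V)}(V)$ is the group of affine transformations of $V$ whose linear part lies in $\mathrm{Sp}(V)$. An affine group of symplectic type is a connected Lie subgroup $H$ of $\mathrm{Aff}_{\mathrm{Sp}(V)}(V)$. It is simply transitive if the orbit map $\varphi:H\to V$, $h\mapsto h0$, is a diffeomorphism. Association $H\mapsto S^H$: let $H$ be Abelian and simply transitive with Lie algebra $\mathfrak h\subset \mathfrak{sp}(V)\ltimes V$, and let $\phi=d\varphi:\mathfrak h\to V$ (a linear isomorphism). Then $\phi^{-1}(X)=(S_X,X)$, where $S_X\in\mathfrak{sp}(V)$ is the linear part and $X$ the translational part, and $S=S^H: X\mapsto S_X$ satisfies $S_XY=S_YX$ for all $X,Y\in V$. So $S$ lies in the first prolongation $\mathfrak{sp}(V)^{(1)}=(V^*\otimes\mathfrak{sp}(V))\cap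 (S^2V^*\otimes V)$. This space is identified with $S^3V^*$ by sending $S$ to the symmetric trilinear form $(X,Y,Z)\mapsto\omega(S_XY,Z)$, and $S^3V^*$ is identified with $S^3V$ by the isomorphism $V\to V^*$, $v\mapsto\omega(v,\cdot)$. Thus $S^H$ is regarded as an element of $S^3V$. *)

theory Defs
  imports "HOL-Analysis.Analysis" "HOL-Algebra.Coset"
begin

text \<open>Only meant for open \<open>S\<close>. Iterated directional derivatives keep the type of \<open>f\<close> fixed,
  so that the recursion on the order of differentiability is possible.\<close>

fun higher_differentiable_on ::
  "nat \<Rightarrow> 'a::real_normed_vector set \<Rightarrow> ('a \<Rightarrow> 'b::real_normed_vector) \<Rightarrow> bool" where
  "higher_differentiable_on 0 S f \<longleftrightarrow> continuous_on S f"
| "higher_differentiable_on (Suc k) S f \<longleftrightarrow>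
     (\<forall>x\<in>S. f differentiable (at x)) \<and>
     (\<forall>v. higher_differentiable_on k S (\<lambda>x. frechet_derivative f (at x) v))"

definition smooth_on :: "'a::real_normed_vector set \<Rightarrow> ('a \<Rightarrow> 'b::real_normed_vector) \<Rightarrow> bool" where
  "smooth_on S f \<longleftrightarrow> (\<forall>k. higher_differentiable_on k S f)"

text \<open>An immersed submanifold of a normed space is represented by its intrinsic topology, a
  topology on a subset which may be finer than the subspace topology. A map is smooth
  if it is continuous for the intrinsic topologies and is, locally in the intrinsic topology of
  the source, the restriction of a smooth map between open subsets of the ambient spaces.\<close>

definition smooth_map ::
  "'a::real_normed_vector topology \<Rightarrow> 'b::real_normed_vector topology \<Rightarrow> ('a \<Rightarrow> 'b) \<Rightarrow> bool" where
  "smooth_map X Y f \<longleftrightarrow> continuous_map X Y f \<and>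
     (\<forall>p\<in>topspace X. \<exists>N A F. openin X N \<and> p \<in> N \<and> open A \<and> N \<subseteq> A \<and>
        smooth_on A F \<and> (\<forall>x\<in>N. F x = f x))"

definition diffeomorphism ::
  "'a::real_normed_vector topology \<Rightarrow> 'b::real_normed_vector topology \<Rightarrow> ('a \<Rightarrow> 'b) \<Rightarrow> bool" where
  "diffeomorphism X Y f \<longleftrightarrow> smooth_map X Y f \<and>
     (\<exists>g. smooth_map Y X g \<and> (\<forall>x\<in>topspace X. g (f x) = x) \<and> (\<forall>y\<in>topspace Y. f (g y) = y))"

text \<open>The charts take values in open subsets of a linear subspace \<open>W\<close> of the (finite-dimensional)
  ambient space; \<open>W\<close> plays the role of \<open>\<real>\<^sup>d\<close>. The inverse of a chart is smooth as a
  map into the ambient space and has a locally smooth left inverse, so it is an immersion.\<close>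

definition immersed_submanifold :: "'a::real_normed_vector topology \<Rightarrow> bool" where
  "immersed_submanifold X \<longleftrightarrow>
     (\<exists>W. subspace W \<and>
        (\<forall>p\<in>topspace X. \<exists>N D (f :: 'a \<Rightarrow> 'a). openin X N \<and> p \<in> N \<and> openin (top_of_set W) D \<and>
           diffeomorphism (subtopology X N) (top_of_set D) f))"

text \<open>Lie subgroups are immersed and need not be closed; \<open>H\<close> carries both the subgroup,
  \<open>topspace H\<close>, and its Lie group topology.\<close>

definition lie_subgroup ::
  "('a::real_normed_vector, 'm) monoid_scheme \<Rightarrow> 'a topology \<Rightarrow> bool" where
  "lie_subgroup G H \<longleftrightarrow>
     subgroup (topspace H) G \<and> immersed_submanifold H \<and>
     smooth_map (prod_topology H H) H (\<lambda>(g, h). g \<otimes>\<^bsub>G\<^esub> h) \<and>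
     smooth_map H H (\<lambda>h. inv\<^bsub>G\<^esub> h)"

text \<open>The Lie algebra as the tangent space at the identity, as a subset of the ambient normed space.\<close>

definition lie_algebra ::
  "('a::real_normed_vector, 'm) monoid_scheme \<Rightarrow> 'a topology \<Rightarrow> 'a set" where
  "lie_algebra G H =
     {v. \<exists>\<gamma> :: real \<Rightarrow> 'a. smooth_map euclidean H \<gamma> \<and> \<gamma> 0 = \<one>\<^bsub>G\<^esub> \<and> (\<gamma> has_vector_derivative v) (at 0)}"

text \<open>A finite-dimensional real vector space is modelled by a type of class \<open>euclidean_space\<close>;
  its inner product serves only to provide the topology.\<close>

definition symplectic_form :: "('a::real_vector \<Rightarrow> 'a \<Rightarrow> real) \<Rightarrow> bool" where
  "symplectic_form \<omega> \<longleftrightarrow>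
     bilinear \<omega> \<and> (\<forall>x. \<omega> x x = 0) \<and> (\<forall>x. (\<forall>y. \<omega> x y = 0) \<longrightarrow> x = 0)"

definition isotropic :: "('a::real_vector \<Rightarrow> 'a \<Rightarrow> real) \<Rightarrow> 'a set \<Rightarrow> bool" where
  "isotropic \<omega> U \<longleftrightarrow> (\<forall>x\<in>U. \<forall>y\<in>U. \<omega> x y = 0)"

definition lagrangian :: "('a::real_vector \<Rightarrow> 'a \<Rightarrow> real) \<Rightarrow> 'a set \<Rightarrow> bool" where
  "lagrangian \<omega> U \<longleftrightarrow> subspace U \<and> isotropic \<omega> U \<and>
     (\<forall>W. subspace W \<and> isotropic \<omega> W \<and> U \<subseteq> W \<longrightarrow> W = U)"

definition symplectic_group :: "('a::euclidean_space \<Rightarrow> 'a \<Rightarrow> real) \<Rightarrow> ('a \<Rightarrow>\<^sub>L 'a) set" where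
  "symplectic_group \<omega> = {A. bij (blinfun_apply A) \<and> (\<forall>x y. \<omega> (A x) (A y) = \<omega> x y)}"

text \<open>The pair \<open>(A, b)\<close> stands for the affine transformation \<open>x \<mapsto> A x + b\<close>. The pairs form a
  finite-dimensional normed space.\<close>

type_synonym 'a aff = "('a \<Rightarrow>\<^sub>L 'a) \<times> 'a"

definition aff_apply :: "'a::real_normed_vector aff \<Rightarrow> 'a \<Rightarrow> 'a" where
  "aff_apply h x = fst h x + snd h"

definition aff_symplectic :: "('a::euclidean_space \<Rightarrow> 'a \<Rightarrow> real) \<Rightarrow> 'a aff monoid" where
  "aff_symplectic \<omega> =
     \<lparr>carrier = symplectic_group \<omega> \<times> UNIV,
      mult = (\<lambda>(A, b) (B, c). (A o\<^sub>L B, A c + b)),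
      one = (id_blinfun, 0)\<rparr>"

lemma aff_apply_mult:
  "aff_apply (g \<otimes>\<^bsub>aff_symplectic \<omega>\<^esub> h) x = aff_apply g (aff_apply h x)"
  by (cases g; cases h) (simp add: aff_apply_def aff_symplectic_def blinfun.add_right)

lemma group_aff_symplectic: "group (aff_symplectic \<omega>)"
proof (rule groupI)
  fix g h k assume g: "g \<in> carrier (aff_symplectic \<omega>)" and h: "h \<in> carrier (aff_symplectic \<omega>)"
    and k: "k \<in> carrier (aff_symplectic \<omega>)"
  show "g \<otimes>\<^bsub>aff_symplectic \<omega>\<^esub> h \<in> carrier (aff_symplectic \<omega>)"
  proof -
    have "bij (blinfun_apply (fst g o\<^sub>L fst h))"
      using g h bij_comp[of "blinfun_apply (fst h)" "blinfun_apply (fst g)"]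
      by (auto simp: aff_symplectic_def symplectic_group_def blinfun_compose.rep_eq)
    then show ?thesis
      using g h by (auto simp: aff_symplectic_def symplectic_group_def)
  qed
  show "g \<otimes>\<^bsub>aff_symplectic \<omega>\<^esub> h \<otimes>\<^bsub>aff_symplectic \<omega>\<^esub> k = g \<otimes>\<^bsub>aff_symplectic \<omega>\<^esub> (h \<otimes>\<^bsub>aff_symplectic \<omega>\<^esub> k)"
    by (cases g; cases h; cases k)
      (auto simp: aff_symplectic_def blinfun.add_right intro: blinfun_eqI)
next
  show "\<one>\<^bsub>aff_symplectic \<omega>\<^esub> \<in> carrier (aff_symplectic \<omega>)"
    by (auto simp: aff_symplectic_def symplectic_group_def bij_def inj_on_def surj_def)
next
  fix g assume g: "g \<in> carrier (aff_symplectic \<omega>)"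
  show "\<one>\<^bsub>aff_symplectic \<omega>\<^esub> \<otimes>\<^bsub>aff_symplectic \<omega>\<^esub> g = g"
    by (cases g) (auto simp: aff_symplectic_def intro: blinfun_eqI)
  obtain A b where gA: "g = (A, b)" by (cases g)
  have bijA: "bij (blinfun_apply A)" and wA: "\<And>x y. \<omega> (A x) (A y) = \<omega> x y"
    using g gA by (auto simp: aff_symplectic_def symplectic_group_def)
  define f where "f = inv_into UNIV (blinfun_apply A)"
  have fA: "f (A x) = x" and Af: "A (f x) = x" for x
    using bijA by (simp_all add: f_def bij_is_inj bij_is_surj surj_f_inv_f)
  have "linear f"
    using fA Af by (intro linearI) (metis blinfun.add_right, metis blinfun.scaleR_right)
  then have B: "blinfun_apply (Blinfun f) = f"
    by (simp add: bounded_linear_Blinfun_apply linear_conv_bounded_linear)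
  have "(Blinfun f, - f b) \<in> carrier (aff_symplectic \<omega>)"
    using wA Af bij_imp_bij_inv[OF bijA]
    by (simp add: aff_symplectic_def symplectic_group_def B) (metis f_def)
  moreover have "(Blinfun f, - f b) \<otimes>\<^bsub>aff_symplectic \<omega>\<^esub> g = \<one>\<^bsub>aff_symplectic \<omega>\<^esub>"
    by (auto simp: gA aff_symplectic_def B fA intro!: blinfun_eqI)
  ultimately show "\<exists>h\<in>carrier (aff_symplectic \<omega>). h \<otimes>\<^bsub>aff_symplectic \<omega>\<^esub> g = \<one>\<^bsub>aff_symplectic \<omega>\<^esub>"
    by blast
qed

definition orbit_map :: "'a::real_normed_vector aff \<Rightarrow> 'a" where
  "orbit_map h = aff_apply h 0"

definition affine_group_symplectic_type ::
  "('a::euclidean_space \<Rightarrow> 'a \<Rightarrow> real) \<Rightarrow> 'a aff topology \<Rightarrow> bool" where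
  "affine_group_symplectic_type \<omega> H \<longleftrightarrow> lie_subgroup (aff_symplectic \<omega>) H \<and> connected_space H"

definition simply_transitive :: "'a::euclidean_space aff topology \<Rightarrow> bool" where
  "simply_transitive H \<longleftrightarrow> diffeomorphism H euclidean orbit_map"

definition abelian_simply_transitive_groups ::
  "('a::euclidean_space \<Rightarrow> 'a \<Rightarrow> real) \<Rightarrow> 'a aff topology set" where
  "abelian_simply_transitive_groups \<omega> =
     {H. affine_group_symplectic_type \<omega> H \<and> simply_transitive H \<and>
         comm_group (aff_symplectic \<omega>\<lparr>carrier := topspace H\<rparr>)}"

text \<open>\<open>K = g H g\<^sup>-\<^sup>1\<close> as Lie subgroups: \<open>homeomorphic_map\<close> says that both the underlying sets
  and the intrinsic topologies correspond.\<close>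

definition aff_conjugate ::
  "('a::euclidean_space \<Rightarrow> 'a \<Rightarrow> real) \<Rightarrow> 'a aff topology \<Rightarrow> 'a aff topology \<Rightarrow> bool" where
  "aff_conjugate \<omega> H K \<longleftrightarrow>
     (\<exists>g\<in>carrier (aff_symplectic \<omega>).
        homeomorphic_map H K
          (\<lambda>h. g \<otimes>\<^bsub>aff_symplectic \<omega>\<^esub> h \<otimes>\<^bsub>aff_symplectic \<omega>\<^esub> inv\<^bsub>aff_symplectic \<omega>\<^esub> g))"

text \<open>For finite-dimensional \<open>V\<close>, the space \<open>V \<otimes> V \<otimes> V\<close> is realised as the space of trilinear
  forms on the dual space; \<open>u \<otimes> v \<otimes> w\<close> is \<open>(\<alpha>, \<beta>, \<gamma>) \<mapsto> \<alpha> u * \<beta> v * \<gamma> w\<close>.\<close>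

type_synonym 'a dual = "'a \<Rightarrow>\<^sub>L real"
type_synonym 'a tensor3 = "'a dual \<Rightarrow>\<^sub>L 'a dual \<Rightarrow>\<^sub>L 'a dual \<Rightarrow>\<^sub>L real"

definition dual_eval :: "'a::real_normed_vector \<Rightarrow> 'a dual \<Rightarrow>\<^sub>L real" where
  "dual_eval v = Blinfun (\<lambda>\<alpha> :: 'a dual. \<alpha> v)"

lemma dual_eval_apply [simp]: "dual_eval v \<alpha> = \<alpha> v"
  unfolding dual_eval_def
  by (subst bounded_linear_Blinfun_apply) (auto intro: bounded_linear_intros)

definition tensor_prod :: "'a::real_normed_vector \<Rightarrow> 'a \<Rightarrow> 'a \<Rightarrow> 'a tensor3" where
  "tensor_prod u v w =
     blinfun_scaleR_left (blinfun_scaleR_left (dual_eval w) o\<^sub>L dual_eval v) o\<^sub>L dual_eval u"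

lemma tensor_prod_apply [simp]: "tensor_prod u v w \<alpha> \<beta> \<gamma> = \<alpha> u * \<beta> v * \<gamma> w"
  by (simp add: tensor_prod_def blinfun.scaleR_left)

definition sym_prod :: "'a::real_normed_vector \<Rightarrow> 'a \<Rightarrow> 'a \<Rightarrow> 'a tensor3" where
  "sym_prod u v w = (1 / 6) *\<^sub>R
     (tensor_prod u v w + tensor_prod u w v + tensor_prod v u w +
      tensor_prod v w u + tensor_prod w u v + tensor_prod w v u)"

text \<open>\<open>sym3 U\<close> is \<open>S\<^sup>3U\<close>, and \<open>sym3 UNIV\<close> is \<open>S\<^sup>3V\<close>.\<close>

definition sym3 :: "'a::real_normed_vector set \<Rightarrow> 'a tensor3 set" where
  "sym3 U = span {sym_prod u v w | u v w. u \<in> U \<and> v \<in> U \<and> w \<in> U}"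

definition precompose ::
  "('a::real_normed_vector \<Rightarrow>\<^sub>L 'b::real_normed_vector) \<Rightarrow> ('b \<Rightarrow>\<^sub>L 'c::real_normed_vector) \<Rightarrow>\<^sub>L ('a \<Rightarrow>\<^sub>L 'c)" where
  "precompose g = Blinfun (\<lambda>\<alpha> :: 'b \<Rightarrow>\<^sub>L 'c. \<alpha> o\<^sub>L g)"

lemma precompose_apply [simp]: "precompose g \<alpha> = \<alpha> o\<^sub>L g"
  unfolding precompose_def
  by (subst bounded_linear_Blinfun_apply) (auto intro: bounded_linear_intros)

definition tensor_map :: "('a::real_normed_vector \<Rightarrow>\<^sub>L 'a) \<Rightarrow> 'a tensor3 \<Rightarrow> 'a tensor3" where
  "tensor_map g T = Blinfun (\<lambda>\<alpha>. precompose (precompose g) o\<^sub>L (T (\<alpha> o\<^sub>L g) o\<^sub>L precompose g))"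

lemma tensor_map_apply [simp]: "tensor_map g T \<alpha> \<beta> \<gamma> = T (\<alpha> o\<^sub>L g) (\<beta> o\<^sub>L g) (\<gamma> o\<^sub>L g)"
  unfolding tensor_map_def
  by (subst bounded_linear_Blinfun_apply) (auto intro!: bounded_linear_intros)

lemma tensor_map_sym_prod: "tensor_map g (sym_prod u v w) = sym_prod (g u) (g v) (g w)"
  by (intro blinfun_eqI)
    (simp add: sym_prod_def blinfun.add_left blinfun.scaleR_left)

definition sp_orbit ::
  "('a::euclidean_space \<Rightarrow> 'a \<Rightarrow> real) \<Rightarrow> 'a tensor3 \<Rightarrow> 'a tensor3 set" where
  "sp_orbit \<omega> T = (\<lambda>g. tensor_map g T) ` symplectic_group \<omega>"

text \<open>\<open>S_lin \<omega> H X\<close> is the linear part \<open>S\<^sub>X\<close> of the preimage of \<open>X\<close> under the differential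
  \<open>d\<phi> : \<hh> \<rightarrow> V\<close> of the orbit map at the identity.\<close>

definition S_lin ::
  "('a::euclidean_space \<Rightarrow> 'a \<Rightarrow> real) \<Rightarrow> 'a aff topology \<Rightarrow> 'a \<Rightarrow> 'a \<Rightarrow>\<^sub>L 'a" where
  "S_lin \<omega> H X =
     fst (inv_into (lie_algebra (aff_symplectic \<omega>) H)
            (frechet_derivative orbit_map (at \<one>\<^bsub>aff_symplectic \<omega>\<^esub>)) X)"

text \<open>The isomorphism \<open>v \<mapsto> \<omega> v \<cdot>\<close> from \<open>V\<close> to its dual sends \<open>u \<otimes> v \<otimes> w\<close> to the trilinear form
  \<open>(X, Y, Z) \<mapsto> \<omega> u X * \<omega> v Y * \<omega> w Z\<close>, that is, to \<open>(X, Y, Z) \<mapsto> T (\<omega> \<cdot> X) (\<omega> \<cdot> Y) (\<omega> \<cdot> Z)\<close>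
  for \<open>T = u \<otimes> v \<otimes> w\<close>. Hence \<open>lower_indices \<omega>\<close> is the induced isomorphism from \<open>V \<otimes> V \<otimes> V\<close>
  to the trilinear forms on \<open>V\<close>.\<close>

definition lower_indices ::
  "('a::euclidean_space \<Rightarrow> 'a \<Rightarrow> real) \<Rightarrow> 'a tensor3 \<Rightarrow> 'a \<Rightarrow> 'a \<Rightarrow> 'a \<Rightarrow> real" where
  "lower_indices \<omega> T X Y Z =
     T (Blinfun (\<lambda>u. \<omega> u X)) (Blinfun (\<lambda>u. \<omega> u Y)) (Blinfun (\<lambda>u. \<omega> u Z))"

lemma lower_indices_tensor_prod:
  assumes "symplectic_form \<omega>"
  shows "lower_indices \<omega> (tensor_prod u v w) X Y Z = \<omega> u X * \<omega> v Y * \<omega> w Z"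
proof -
  have "blinfun_apply (Blinfun (\<lambda>u. \<omega> u X)) = (\<lambda>u. \<omega> u X)" for X
    using assms
    by (simp add: symplectic_form_def bilinear_def bounded_linear_Blinfun_apply
        linear_conv_bounded_linear)
  then show ?thesis
    by (simp add: lower_indices_def)
qed

definition S_tensor ::
  "('a::euclidean_space \<Rightarrow> 'a \<Rightarrow> real) \<Rightarrow> 'a aff topology \<Rightarrow> 'a tensor3" where
  "S_tensor \<omega> H =
     (THE T. T \<in> sym3 UNIV \<and> (\<forall>X Y Z. lower_indices \<omega> T X Y Z = \<omega> (S_lin \<omega> H X Y) Z))"

definition conjugacy_rel ::
  "('a::euclidean_space \<Rightarrow> 'a \<Rightarrow> real) \<Rightarrow> ('a aff topology \<times> 'a aff topology) set" where
  "conjugacy_rel \<omega> =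
     {(H, K). H \<in> abelian_simply_transitive_groups \<omega> \<and> K \<in> abelian_simply_transitive_groups \<omega> \<and>
              aff_conjugate \<omega> H K}"

definition sp_equivalence_rel ::
  "('a::euclidean_space \<Rightarrow> 'a \<Rightarrow> real) \<Rightarrow> 'a set \<Rightarrow> ('a tensor3 \<times> 'a tensor3) set" where
  "sp_equivalence_rel \<omega> U = {(T, T'). T \<in> sym3 U \<and> T' \<in> sym3 U \<and> T' \<in> sp_orbit \<omega> T}"

end

theory Submission
  imports Defs
begin

text \<open>A simply transitive group \<open>H\<close> consists of one element \<open>(A x, x)\<close> for each \<open>x \<in> V\<close>. If \<open>H\<close> is
  Abelian, then \<open>A x y + x = A y x + y\<close>, and differentiating at \<open>0\<close> gives \<open>A x = id + S x\<close> with \<open>S\<close>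
  bilinear and symmetric; so \<open>H\<close> is the affine subspace \<open>{(id + S x, x)}\<close>, without any use of the
  exponential map. The group law yields \<open>S (S x y) = S x S y\<close>. Both \<open>S (S x y)\<close> and the commuting
  \<open>S x\<close>, \<open>S y\<close> are skew for \<open>\<omega>\<close>, whereas \<open>S x S y\<close> is symmetric, so \<open>S x S y = 0\<close>. Hence the image
  of \<open>S\<close> is isotropic, is contained in a Lagrangian subspace and can be moved into \<open>U\<close> by the
  transitivity of \<open>Sp(V)\<close> on Lagrangian subspaces. Conversely every tensor in \<open>S\<^sup>3U\<close> satisfies
  \<open>S x S y = 0\<close> and defines a group. Translations act trivially on \<open>S\<close> and linear maps act
  naturally, so conjugacy of groups is \<open>Sp(V)\<close>-equivalence of tensors.\<close>

section \<open>Orthogonal projections\<close>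

text \<open>The set \<open>B\<close> is an orthonormal basis of \<open>L\<close>. It gives the
  projection onto \<open>L\<close> here and the coordinates in which symmetric tensors are built
  later.\<close>

lemma orthonormal_expansion_subspace:
  fixes L :: "'a::euclidean_space set"
  assumes "subspace L"
  obtains B where "finite B" "B \<subseteq> L" "\<And>x. x \<in> L \<Longrightarrow> (\<Sum>b\<in>B. (x \<bullet> b) *\<^sub>R b) = x"
proof -
  obtain B where "B \<subseteq> L" "pairwise orthogonal B" "\<And>x. x \<in> B \<Longrightarrow> norm x = 1"
    "independent B" "span B = L"
    using orthonormal_basis_subspace[OF assms] by metis
  moreover from this have "finite B"
    by (simp add: independent_imp_finite)
  ultimately show thesis
    using that orthonormal_basis_expand by metis
qed

lemma linear_sum_inner_scaleR: "linear (\<lambda>x::'a::real_inner. \<Sum>b\<in>B. (x \<bullet> b) *\<^sub>R (f b :: 'b::real_vector))"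
  by (rule linearI) (simp_all add: inner_add_left scaleR_left_distrib sum.distrib scaleR_sum_right)

lemma orthogonal_projection_exists:
  fixes L :: "'a::euclidean_space set"
  assumes "subspace L"
  obtains P where "linear P" "\<And>x. P x \<in> L" "\<And>x y. y \<in> L \<Longrightarrow> P x \<bullet> y = x \<bullet> y"
proof -
  obtain B where B: "finite B" "B \<subseteq> L" "\<And>x. x \<in> L \<Longrightarrow> (\<Sum>b\<in>B. (x \<bullet> b) *\<^sub>R b) = x"
    using orthonormal_expansion_subspace[OF assms] by metis
  define P where "P = (\<lambda>x. \<Sum>b\<in>B. (x \<bullet> b) *\<^sub>R b)"
  show thesis
  proof
    show "linear P"
      unfolding P_def by (rule linear_sum_inner_scaleR)
    show "P x \<in> L" for x
      unfolding P_def using B(2) assms by (intro subspace_sum subspace_scale) auto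
    show "P x \<bullet> y = x \<bullet> y" if "y \<in> L" for x y
    proof -
      have "P x \<bullet> y = x \<bullet> (\<Sum>b\<in>B. (y \<bullet> b) *\<^sub>R b)"
        by (simp add: P_def inner_sum_left inner_sum_right inner_commute mult.commute)
      then show ?thesis
        by (simp add: B(3)[OF that])
    qed
  qed
qed

section \<open>Induced maps on tensors\<close>

lemma tensor_map_linear:
  "tensor_map g 0 = 0" "tensor_map g (T + T') = tensor_map g T + tensor_map g T'"
  "tensor_map g (c *\<^sub>R T) = c *\<^sub>R tensor_map g T"
  by (intro blinfun_eqI; simp add: blinfun.add_left blinfun.scaleR_left blinfun.zero_left)+

lemma tensor_map_compose: "tensor_map g (tensor_map h T) = tensor_map (g o\<^sub>L h) T"
proof -
  have "(\<alpha> o\<^sub>L g) o\<^sub>L h = \<alpha> o\<^sub>L (g o\<^sub>L h)" for \<alpha> :: "'a dual"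
    by (rule blinfun_eqI) simp
  then show ?thesis
    by (intro blinfun_eqI) simp
qed

lemma tensor_map_id: "tensor_map id_blinfun T = T"
proof -
  have "\<alpha> o\<^sub>L id_blinfun = \<alpha>" for \<alpha> :: "'a dual"
    by (rule blinfun_eqI) simp
  then show ?thesis
    by (intro blinfun_eqI) simp
qed

section \<open>Smoothness of affine and quadratic maps\<close>

lemma higher_differentiable_on_const: "higher_differentiable_on k S (\<lambda>_. c)"
  by (induction k arbitrary: c) auto

lemma higher_differentiable_on_affine:
  assumes "bounded_linear f"
  shows "higher_differentiable_on k S (\<lambda>x. f x + c)"
proof (cases k)
  case 0
  with assms show ?thesis
    by (simp add: continuous_on_add linear_continuous_on)
next
  case (Suc m)
  have d: "((\<lambda>x. f x + c) has_derivative f) (at x)" for x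
    using assms by (auto intro!: derivative_eq_intros bounded_linear_imp_has_derivative)
  have "frechet_derivative (\<lambda>x. f x + c) (at x) = f" for x
    by (rule frechet_derivative_at[OF d, symmetric])
  with d[THEN differentiableI] Suc show ?thesis
    by (simp add: higher_differentiable_on_const)
qed

lemma smooth_on_affine: "bounded_linear f \<Longrightarrow> smooth_on S (\<lambda>x. f x + c)"
  by (simp add: smooth_on_def higher_differentiable_on_affine)

text \<open>This is the criterion for quadratic maps. In each fixed direction the derivative is
  affine in the base point, so all higher orders reduce to the affine case.\<close>

lemma smooth_on_affine_derivative:
  assumes d: "\<And>x. (f has_derivative f' x) (at x)"
    and f': "\<And>v. \<exists>l c. bounded_linear l \<and> (\<forall>x. f' x v = l x + c)"
  shows "smooth_on S f"
  unfolding smooth_on_def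
proof
  fix k
  have "frechet_derivative f (at x) = f' x" for x
    by (rule frechet_derivative_at[OF d, symmetric])
  moreover have "higher_differentiable_on m S (\<lambda>x. f' x v)" for m v
  proof -
    obtain l c where "bounded_linear l" "\<And>x. f' x v = l x + c"
      using f' by blast
    then show ?thesis
      using higher_differentiable_on_affine[of l m S c] by simp
  qed
  moreover have "continuous_on S f"
    by (rule has_derivative_continuous_on) (rule has_derivative_at_withinI[OF d])
  ultimately show "higher_differentiable_on k S f"
    using d[THEN differentiableI] by (cases k) simp_all
qed

lemma smooth_on_imp_continuous_on: "smooth_on S f \<Longrightarrow> continuous_on S f"
  unfolding smooth_on_def by (drule spec[of _ 0]) simp

text \<open>A single extension \<open>F\<close>, smooth on the whole ambient space, serves as the
  local extension at every point of \<open>C\<close>.\<close>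

lemma smooth_map_top_of_setI:
  assumes "smooth_on UNIV F" and "\<And>x. x \<in> C \<Longrightarrow> F x = f x" and "f ` C \<subseteq> D"
  shows "smooth_map (top_of_set C) (top_of_set D) f"
proof -
  have "continuous_on C F"
    using smooth_on_imp_continuous_on[OF assms(1)] continuous_on_subset by blast
  then have "continuous_on C f"
    using assms(2) by (simp cong: continuous_on_cong)
  then have "continuous_map (top_of_set C) (top_of_set D) f"
    using assms(3) by (auto simp: continuous_map_in_subtopology)
  moreover have "openin (top_of_set C) C"
    by simp
  ultimately show ?thesis
    unfolding smooth_map_def using assms(1,2)
    by (metis open_UNIV openin_subtopology_self subset_UNIV topspace_euclidean_subtopology)
qed

section \<open>Symplectic linear algebra\<close>

locale symplectic_space =
  fixes \<omega> :: "'a::euclidean_space \<Rightarrow> 'a \<Rightarrow> real"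
  assumes symplectic: "symplectic_form \<omega>"
begin

lemma bilinear_form: "bilinear \<omega>"
  using symplectic by (simp add: symplectic_form_def)

lemmas form_simps =
  bilinear_ladd[OF bilinear_form] bilinear_radd[OF bilinear_form]
  bilinear_lsub[OF bilinear_form] bilinear_rsub[OF bilinear_form]
  bilinear_lmul[OF bilinear_form] bilinear_rmul[OF bilinear_form]
  bilinear_lneg[OF bilinear_form] bilinear_rneg[OF bilinear_form]
  bilinear_lzero[OF bilinear_form] bilinear_rzero[OF bilinear_form]

lemma form_self [simp]: "\<omega> x x = 0"
  using symplectic by (simp add: symplectic_form_def)

lemma linear_form_left: "linear (\<lambda>u. \<omega> u x)" and linear_form_right: "linear (\<omega> x)"
  using bilinear_form by (simp_all add: bilinear_def)

lemma form_skew: "\<omega> x y = - \<omega> y x"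
proof -
  have "\<omega> (x + y) (x + y) = 0"
    by simp
  then show ?thesis
    unfolding form_simps by simp
qed

lemma form_eqI:
  assumes "\<And>z. \<omega> x z = \<omega> y z"
  shows "x = y"
proof -
  have "\<forall>z. \<omega> (x - y) z = 0"
    by (simp add: form_simps assms)
  then have "x - y = 0"
    using symplectic unfolding symplectic_form_def by blast
  then show ?thesis
    by simp
qed

lemma form_eqI':
  assumes "\<And>z. \<omega> z x = \<omega> z y"
  shows "x = y"
  by (rule form_eqI) (simp add: form_skew[of x] form_skew[of y] assms)

text \<open>\<open>K\<close> is the Gram operator of \<omega> with respect to the inner product.
  Nondegeneracy makes it injective, hence invertible in finite dimension; \<open>J\<close> is its
  inverse and turns inner products into values of \<omega>.\<close>

lemma form_inner_isomorphism:
  obtains J K where "linear J" "linear K" "\<And>x y. \<omega> x (J y) = x \<bullet> y" "\<And>x y. x \<bullet> K y = \<omega> x y"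
    "\<And>x. J (K x) = x" "\<And>x. K (J x) = x"
proof -
  define K where "K = (\<lambda>x. \<Sum>i\<in>Basis. \<omega> i x *\<^sub>R i)"
  have "linear K"
    unfolding K_def by (rule linearI) (simp_all add: form_simps scaleR_left_distrib sum.distrib scaleR_sum_right)
  have xK: "x \<bullet> K y = \<omega> x y" for x y
  proof -
    have "\<omega> x y = \<omega> (\<Sum>i\<in>Basis. (x \<bullet> i) *\<^sub>R i) y"
      by (simp add: euclidean_representation)
    also have "\<dots> = (\<Sum>i\<in>Basis. (x \<bullet> i) * \<omega> i y)"
      by (simp add: linear_sum[OF linear_form_left] form_simps)
    finally show ?thesis
      by (simp add: K_def inner_sum_right mult.commute)
  qed
  have "inj K"
    by (rule injI, rule form_eqI') (simp flip: xK)
  then obtain J where J: "linear J" "\<And>x. J (K x) = x" "\<And>x. K (J x) = x"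
    using linear_injective_isomorphism[OF \<open>linear K\<close>] by metis
  then have "\<omega> x (J y) = x \<bullet> y" for x y
    by (metis xK)
  with that J \<open>linear K\<close> xK show thesis
    by metis
qed

section \<open>Lagrangian subspaces and their complements\<close>

lemma lagrangianD:
  assumes "lagrangian \<omega> L"
  shows "subspace L" and "\<And>x y. x \<in> L \<Longrightarrow> y \<in> L \<Longrightarrow> \<omega> x y = 0"
    and "\<And>v. (\<And>x. x \<in> L \<Longrightarrow> \<omega> x v = 0) \<Longrightarrow> v \<in> L"
proof -
  show sub: "subspace L" and iso: "\<And>x y. x \<in> L \<Longrightarrow> y \<in> L \<Longrightarrow> \<omega> x y = 0"
    using assms by (auto simp: lagrangian_def isotropic_def)
  fix v assume v: "\<And>x. x \<in> L \<Longrightarrow> \<omega> x v = 0"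
  \<comment> \<open>Adjoining a vector orthogonal to \<open>L\<close> keeps the span isotropic, so
    maximality puts the vector in \<open>L\<close>. Thus \<open>L\<close> contains its own
    \<omega>-complement.\<close>
  have "\<omega> x y = 0" if xy: "x \<in> span (insert v L)" "y \<in> span (insert v L)" for x y
  proof -
    obtain a b where "x - a *\<^sub>R v \<in> L" "y - b *\<^sub>R v \<in> L"
      using xy sub by (auto simp: span_breakdown_eq span_eq_iff[THEN iffD2])
    then have "\<omega> ((x - a *\<^sub>R v) + a *\<^sub>R v) ((y - b *\<^sub>R v) + b *\<^sub>R v) = 0"
      unfolding form_simps(1,2,5,6) using iso v v[THEN trans[OF form_skew, OF arg_cong[of _ 0 uminus]]] by simp
    then show ?thesis
      by simp
  qed
  then have "span (insert v L) = L"
    using assms unfolding lagrangian_def isotropic_def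
    by (metis subspace_span span_superset insert_subset subset_trans)
  then show "v \<in> L"
    by (metis insertI1 span_base)
qed

text \<open>The span of \<open>W\<close> is isotropic, and an isotropic subspace of greatest
  dimension among those containing \<open>W\<close> cannot be enlarged.\<close>

lemma isotropic_subset_lagrangian:
  assumes "isotropic \<omega> W"
  obtains L where "lagrangian \<omega> L" "W \<subseteq> L"
proof -
  have span_left: "\<omega> x y = 0" if "x \<in> span W" "y \<in> W" for x y
    using that(1) by (induction rule: span_induct)
      (use assms that(2) in \<open>auto simp: subspace_def form_simps isotropic_def\<close>)
  have iso: "\<omega> x y = 0" if "y \<in> span W" "x \<in> span W" for x y
    using that(1) by (induction rule: span_induct)
      (use span_left that(2) in \<open>auto simp: subspace_def form_simps\<close>)
  define Q where "Q M \<longleftrightarrow> subspace M \<and> isotropic \<omega> M \<and> W \<subseteq> M" for M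
  have "Q (span W)"
    using iso by (auto simp: Q_def isotropic_def span_superset)
  then obtain L where L: "Q L" "\<And>M. Q M \<Longrightarrow> dim M \<le> dim L"
    using ex_has_greatest_nat[of Q "span W" dim "Suc DIM('a)"]
    by (auto simp: less_Suc_eq_le dim_subset_UNIV)
  have "lagrangian \<omega> L"
    unfolding lagrangian_def
  proof (intro conjI allI impI)
    fix M assume M: "subspace M \<and> isotropic \<omega> M \<and> L \<subseteq> M"
    then have "Q M"
      using L(1) by (auto simp: Q_def)
    then show "M = L"
      using L M subspace_dim_equal[of L M] by (auto simp: Q_def)
  qed (use L(1) in \<open>auto simp: Q_def\<close>)
  with that L(1) show thesis
    by (auto simp: Q_def)
qed

text \<open>\<open>F\<close> identifies \<open>L\<close>, as its own dual, with a Lagrangian complement of \<open>L\<close>.\<close>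

lemma lagrangian_splitting:
  assumes "lagrangian \<omega> L"
  obtains F Y where "linear F" "linear Y"
    "\<And>x y. x \<in> L \<Longrightarrow> y \<in> L \<Longrightarrow> \<omega> x (F y) = x \<bullet> y"
    "\<And>x y. x \<in> L \<Longrightarrow> y \<in> L \<Longrightarrow> \<omega> (F x) (F y) = 0"
    "\<And>v. Y v \<in> L" "\<And>v. v - F (Y v) \<in> L"
proof -
  obtain J K where JK: "linear J" "linear K" "\<And>x y. \<omega> x (J y) = x \<bullet> y" "\<And>x y. x \<bullet> K y = \<omega> x y"
    using form_inner_isomorphism by metis
  obtain P where P: "linear P" "\<And>x. P x \<in> L" "\<And>x y. y \<in> L \<Longrightarrow> P x \<bullet> y = x \<bullet> y"
    using orthogonal_projection_exists[OF lagrangianD(1)[OF assms]] by metis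
  \<comment> \<open>The image of \<open>L\<close> under \<open>J\<close> need not be isotropic. The
    correction lies in \<open>L\<close>, so it does not change the pairing with \<open>L\<close>;
    the factor 1/2 appears because both arguments of \<omega> are corrected, each removing half of
    \<open>\<omega> (J x) (J y)\<close>.\<close>
  define F where "F y = J y - (1/2) *\<^sub>R P (J y)" for y
  \<comment> \<open>\<open>Y v\<close> is the vector of \<open>L\<close> whose inner product with
    each \<open>x\<close> in \<open>L\<close> is \<open>\<omega> x v\<close>; hence
    \<open>v - F (Y v)\<close> is orthogonal to \<open>L\<close>.\<close>
  define Y where "Y v = P (K v)" for v
  have lF: "linear F"
    unfolding F_def using linear_compose[OF JK(1) P(1)]
    by (intro linear_compose_sub linear_compose_scale_right JK) (simp add: o_def)
  have lY: "linear Y"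
    unfolding Y_def using linear_compose[OF JK(2) P(1)] by (simp add: o_def)
  have LF: "\<omega> x (F y) = x \<bullet> y" if "x \<in> L" for x y
    using that P(2) lagrangianD(2)[OF assms] by (simp add: F_def form_simps JK)
  have FF: "\<omega> (F x) (F y) = 0" if "x \<in> L" "y \<in> L" for x y
  proof -
    have "\<omega> (F x) (F y) = \<omega> (J x) (J y) - (1/2) * (P (J y) \<bullet> - x) - (1/2) * (P (J x) \<bullet> y)"
      using form_skew[of "J x" "P (J y)"] P(2) lagrangianD(2)[OF assms]
      by (simp add: F_def form_simps JK inner_diff_left)
    also have "\<dots> = \<omega> (J x) (J y) + (1/2) * \<omega> (J y) (J x) - (1/2) * \<omega> (J x) (J y)"
      using that by (simp add: P(3) JK)
    finally show ?thesis
      using form_skew[of "J x" "J y"] by simp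
  qed
  have "v - F (Y v) \<in> L" for v
  proof (rule lagrangianD(3)[OF assms])
    fix x assume "x \<in> L"
    then show "\<omega> x (v - F (Y v)) = 0"
      unfolding form_simps LF[OF \<open>x \<in> L\<close>] Y_def
      using P(3)[of x "K v"] by (simp add: inner_commute[of x] JK(4)[symmetric])
  qed
  with that[of F Y] lF lY LF FF P(2) show thesis
    by (auto simp: Y_def)
qed

lemma dim_lagrangian:
  assumes "lagrangian \<omega> L"
  shows "DIM('a) = 2 * dim L"
proof -
  obtain F Y where F: "linear F" "linear Y"
    "\<And>x y. x \<in> L \<Longrightarrow> y \<in> L \<Longrightarrow> \<omega> x (F y) = x \<bullet> y"
    "\<And>x y. x \<in> L \<Longrightarrow> y \<in> L \<Longrightarrow> \<omega> (F x) (F y) = 0"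
    "\<And>v. Y v \<in> L" "\<And>v. v - F (Y v) \<in> L"
    by (rule lagrangian_splitting[OF assms]) (rule that)
  note L = lagrangianD[OF assms]
  have 0: "x = 0" if "x \<in> L" "F x \<in> L" for x
    using F(3)[OF that(1) that(1)] L(2)[OF that] by simp
  have "inj_on F (span L)"
    unfolding linear_inj_on_iff_eq_0[OF F(1) subspace_span]
    using 0 L(1) by (metis span_eq_iff subspace_0)
  then have "dim (F ` L) = dim L"
    by (rule dim_image_eq[OF F(1)])
  moreover have "L \<inter> F ` L = {0}"
    using 0 linear_0[OF F(1)] subspace_0[OF L(1)] by (force intro: image_eqI[of 0 F 0])
  moreover have "v \<in> {x + y |x y. x \<in> L \<and> y \<in> F ` L}" for v
    using F(5,6)[of v] by (force intro: exI[of _ "v - F (Y v)"] exI[of _ "F (Y v)"])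
  then have "{x + y |x y. x \<in> L \<and> y \<in> F ` L} = UNIV"
    by blast
  ultimately show ?thesis
    using dim_sums_Int[OF L(1) linear_subspace_image[OF F(1) L(1)]] by simp
qed

section \<open>The symplectic group and its transitivity on Lagrangian subspaces\<close>

lemma symplectic_groupI:
  assumes "\<And>x y. \<omega> (blinfun_apply A x) (A y) = \<omega> x y"
  shows "A \<in> symplectic_group \<omega>"
proof -
  \<comment> \<open>A map preserving a nondegenerate form is injective, and in finite dimension
    injective linear endomorphisms are bijective.\<close>
  have "inj (blinfun_apply A)"
  proof (rule injI)
    fix x y assume "blinfun_apply A x = A y"
    then have "\<omega> x z = \<omega> y z" for z
      using assms[of x z] assms[of y z] by simp
    then show "x = y"
      by (rule form_eqI)
  qed
  then have "bij (blinfun_apply A)"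
    using linear_injective_imp_surjective[of "blinfun_apply A"]
    by (simp add: bij_def bounded_linear.linear[OF blinfun.bounded_linear_right])
  with assms show ?thesis
    by (simp add: symplectic_group_def)
qed

lemma symplectic_groupD: "A \<in> symplectic_group \<omega> \<Longrightarrow> \<omega> (blinfun_apply A x) (A y) = \<omega> x y"
  by (simp add: symplectic_group_def)

lemma symplectic_group_id: "id_blinfun \<in> symplectic_group \<omega>"
  by (rule symplectic_groupI) simp

lemma symplectic_group_compose:
  "A \<in> symplectic_group \<omega> \<Longrightarrow> B \<in> symplectic_group \<omega> \<Longrightarrow> A o\<^sub>L B \<in> symplectic_group \<omega>"
  by (rule symplectic_groupI) (simp add: symplectic_groupD)

lemma symplectic_group_inverse:
  assumes "A \<in> symplectic_group \<omega>"
  obtains B where "B \<in> symplectic_group \<omega>" "\<And>x. A (B x) = x" "\<And>x. B (A x) = x"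
    "A o\<^sub>L B = id_blinfun" "B o\<^sub>L A = id_blinfun"
proof -
  have "inj (blinfun_apply A)"
    using assms by (simp add: symplectic_group_def bij_is_inj)
  then obtain f where f: "linear f" "\<And>x. f (A x) = x" "\<And>x. A (f x) = x"
    using linear_injective_isomorphism[OF bounded_linear.linear[OF blinfun.bounded_linear_right]] by blast
  define B where "B = Blinfun f"
  have B: "blinfun_apply B = f"
    using f(1) by (simp add: B_def bounded_linear_Blinfun_apply linear_conv_bounded_linear)
  show thesis
  proof
    show "B \<in> symplectic_group \<omega>"
      by (rule symplectic_groupI) (metis (no_types) B assms f(3) symplectic_groupD)
  qed (auto simp: B f intro: blinfun_eqI)
qed

text \<open>In a splitting, \<omega> is determined by the inner product on the Lagrangian subspace.
  So a linear isometry from \<open>L\<close> onto \<open>U\<close>, which exists because the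
  dimensions agree, extends to a symplectic map between the two splittings.\<close>

lemma symplectic_group_transitive_lagrangian:
  assumes "lagrangian \<omega> L" and "lagrangian \<omega> U"
  obtains g where "g \<in> symplectic_group \<omega>" "\<And>x. x \<in> L \<Longrightarrow> blinfun_apply g x \<in> U"
proof -
  note L = lagrangianD[OF assms(1)] and U = lagrangianD[OF assms(2)]
  obtain F Y where F: "linear F" "linear Y"
    "\<And>x y. x \<in> L \<Longrightarrow> y \<in> L \<Longrightarrow> \<omega> x (F y) = x \<bullet> y"
    "\<And>x y. x \<in> L \<Longrightarrow> y \<in> L \<Longrightarrow> \<omega> (F x) (F y) = 0"
    "\<And>v. Y v \<in> L" "\<And>v. v - F (Y v) \<in> L"
    by (rule lagrangian_splitting[OF assms(1)]) (rule that)
  obtain E Z where E: "linear E" "linear Z"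
    "\<And>x y. x \<in> U \<Longrightarrow> y \<in> U \<Longrightarrow> \<omega> x (E y) = x \<bullet> y"
    "\<And>x y. x \<in> U \<Longrightarrow> y \<in> U \<Longrightarrow> \<omega> (E x) (E y) = 0"
    "\<And>v. Z v \<in> U" "\<And>v. v - E (Z v) \<in> U"
    by (rule lagrangian_splitting[OF assms(2)]) (rule that)
  have "dim L = dim U"
    using dim_lagrangian[OF assms(1)] dim_lagrangian[OF assms(2)] by simp
  then obtain h where h: "linear h" "h ` L = U" "\<And>x. x \<in> L \<Longrightarrow> norm (h x) = norm x"
    using isometries_subspaces[OF L(1) U(1)] by metis
  have hh: "h x \<bullet> h y = x \<bullet> y" if "x \<in> L" "y \<in> L" for x y
    using h(3)[of x] h(3)[of y] h(3)[of "x + y"] that subspace_add[OF L(1)]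
    by (simp add: dot_norm linear_add[OF h(1)])
  have hU: "h x \<in> U" if "x \<in> L" for x
    using h(2) that by blast
  \<comment> \<open>Writing \<open>v = x + F y\<close> with \<open>x\<close> and \<open>y\<close> in
    \<open>L\<close>, the map sends \<open>v\<close> to \<open>h x + E (h y)\<close>.\<close>
  define f where "f v = h (v - F (Y v)) + E (h (Y v))" for v
  have "linear f"
    unfolding f_def
    by (intro linear_compose_add linear_compose[OF _ h(1), unfolded o_def]
        linear_compose[OF _ E(1), unfolded o_def] linear_compose_sub
        linear_compose[OF F(2) F(1), unfolded o_def] linear_ident F(2))
  then have f: "blinfun_apply (Blinfun f) = f"
    by (simp add: bounded_linear_Blinfun_apply linear_conv_bounded_linear)
  have "\<omega> (f v) (f w) = \<omega> v w" for v w
  proof -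
    define x y x' y' where d: "x = v - F (Y v)" "y = Y v" "x' = w - F (Y w)" "y' = Y w"
    have in_L: "x \<in> L" "y \<in> L" "x' \<in> L" "y' \<in> L"
      using F(5,6) by (auto simp: d)
    have "\<omega> (f v) (f w) = h x \<bullet> h y' - h x' \<bullet> h y"
      unfolding f_def d(2,4)[symmetric] d(1)[symmetric, folded d(2)] d(3)[symmetric, folded d(4)] form_simps
      using in_L form_skew[of "E (h y)" "h x'"] by (simp add: hU U(2) E(3,4))
    also have "\<dots> = x \<bullet> y' - x' \<bullet> y"
      using in_L by (simp add: hh)
    also have "\<dots> = \<omega> (x + F y) (x' + F y')"
      unfolding form_simps
      using in_L form_skew[of "F y" x'] by (simp add: L(2) F(3,4))
    finally show ?thesis
      by (simp add: d)
  qed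
  then have "Blinfun f \<in> symplectic_group \<omega>"
    by (intro symplectic_groupI) (simp add: f)
  moreover have "f x \<in> U" if "x \<in> L" for x
  proof -
    \<comment> \<open>For \<open>x\<close> in \<open>L\<close> the component along the complement
      vanishes: \<open>F (Y x)\<close> lies in \<open>L\<close>, so the pairing
      \<open>Y x \<bullet> Y x = \<omega> (Y x) (F (Y x))\<close> is zero.\<close>
    have "F (Y x) \<in> L"
      using subspace_diff[OF L(1) that F(6)[of x]] by simp
    then have "Y x = 0"
      using F(3)[OF F(5) F(5), of x x] L(2)[OF F(5), of "F (Y x)" x] by simp
    then show ?thesis
      using hU[OF that] by (simp add: f_def linear_0 F(1) h(1) E(1))
  qed
  ultimately show thesis
    using that[of "Blinfun f"] by (simp add: f)
qed

section \<open>Affine groups of prolongation tensors\<close>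

definition prolongation_tensor :: "('a \<Rightarrow>\<^sub>L 'a \<Rightarrow>\<^sub>L 'a) \<Rightarrow> bool" where
  "prolongation_tensor S \<longleftrightarrow>
     (\<forall>x y. S x y = S y x) \<and> (\<forall>x y z. \<omega> (S x y) z = - \<omega> y (S x z))"

definition abelian_tensor :: "('a \<Rightarrow>\<^sub>L 'a \<Rightarrow>\<^sub>L 'a) \<Rightarrow> bool" where
  "abelian_tensor S \<longleftrightarrow> prolongation_tensor S \<and> (\<forall>x y z. S x (S y z) = 0)"

definition aff_elem :: "('a \<Rightarrow>\<^sub>L 'a \<Rightarrow>\<^sub>L 'a) \<Rightarrow> 'a \<Rightarrow> 'a aff" where
  "aff_elem S y = (id_blinfun + S y, y)"

text \<open>The subspace topology is the right Lie group topology here, since the underlying set is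
  an affine subspace of the space of pairs.\<close>

definition aff_group :: "('a \<Rightarrow>\<^sub>L 'a \<Rightarrow>\<^sub>L 'a) \<Rightarrow> 'a aff topology" where
  "aff_group S = top_of_set (range (aff_elem S))"

lemma prolongation_tensorD:
  assumes "prolongation_tensor S"
  shows "blinfun_apply (S x) y = S y x" and "\<omega> (S x y) z = - \<omega> y (S x z)"
  using assms unfolding prolongation_tensor_def by blast+

lemma abelian_tensorD:
  assumes "abelian_tensor S"
  shows "blinfun_apply (S x) y = S y x" and "\<omega> (S x y) z = - \<omega> y (S x z)"
    and "S x (S y z) = 0" and "S (S x y) = 0"
proof -
  show "blinfun_apply (S x) y = S y x" and "\<omega> (S x y) z = - \<omega> y (S x z)" and 0: "S x (S y z) = 0" for x y z
    using assms prolongation_tensorD unfolding abelian_tensor_def by blast+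
  then show "S (S x y) = 0"
    by (intro blinfun_eqI) (metis blinfun.zero_left)
qed

section \<open>The group law on the elements \<open>aff_elem S x\<close>\<close>

abbreviation "G \<equiv> aff_symplectic \<omega>"

lemma group_G: "group G"
  by (rule group_aff_symplectic)

lemma carrier_G: "carrier G = symplectic_group \<omega> \<times> UNIV"
  and mult_G: "(A, b) \<otimes>\<^bsub>G\<^esub> (C, c) = (A o\<^sub>L C, A c + b)"
  and one_G: "\<one>\<^bsub>G\<^esub> = (id_blinfun, 0)"
  by (simp_all add: aff_symplectic_def)

lemma mult_G_eq: "g \<otimes>\<^bsub>G\<^esub> h = (fst g o\<^sub>L fst h, fst g (snd h) + snd g)"
  by (cases g; cases h) (simp add: mult_G)

lemma inv_G:
  assumes "A \<in> symplectic_group \<omega>" "B \<in> symplectic_group \<omega>" "B o\<^sub>L A = id_blinfun"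
  shows "inv\<^bsub>G\<^esub> (A, b) = (B, - B b)"
  using assms by (intro group.inv_equality[OF group_G]) (simp_all add: mult_G one_G carrier_G)

lemma aff_elem_0: "aff_elem S 0 = \<one>\<^bsub>G\<^esub>"
  by (simp add: aff_elem_def one_G blinfun.zero_right)

lemma snd_aff_elem [simp]: "snd (aff_elem S y) = y"
  by (simp add: aff_elem_def)

lemma orbit_map_eq_snd: "orbit_map = (snd :: 'a aff \<Rightarrow> 'a)"
  by (rule ext) (simp add: orbit_map_def aff_apply_def blinfun.zero_right)

text \<open>The terms of \<omega> linear in \<open>S x\<close> cancel by skewness, and the quadratic
  term becomes \<open>\<omega> y (S x (S x z))\<close> up to sign, which is zero.\<close>

lemma aff_elem_carrier:
  assumes "abelian_tensor S"
  shows "aff_elem S x \<in> carrier G"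
proof -
  note S = abelian_tensorD[OF assms]
  have "id_blinfun + S x \<in> symplectic_group \<omega>"
    by (rule symplectic_groupI) (simp add: blinfun.add_left form_simps S(2,3))
  then show ?thesis
    by (simp add: aff_elem_def carrier_G)
qed

text \<open>Vanishing of \<open>S x (S y z)\<close> removes the quadratic term of the composed
  linear parts, and vanishing of \<open>S (S x y)\<close> makes what remains equal to
  \<open>id + S (x + y + S x y)\<close>.\<close>

lemma aff_elem_mult:
  assumes "abelian_tensor S"
  shows "aff_elem S x \<otimes>\<^bsub>G\<^esub> aff_elem S y = aff_elem S (x + y + S x y)"
  using abelian_tensorD[OF assms]
  by (auto simp: aff_elem_def mult_G blinfun.add_left blinfun.add_right intro!: blinfun_eqI)

lemma aff_elem_inv:
  assumes "abelian_tensor S"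
  shows "inv\<^bsub>G\<^esub> (aff_elem S x) = aff_elem S (S x x - x)"
proof (rule group.inv_equality[OF group_G])
  show "aff_elem S (S x x - x) \<otimes>\<^bsub>G\<^esub> aff_elem S x = \<one>\<^bsub>G\<^esub>"
    using abelian_tensorD[OF assms]
    by (simp add: aff_elem_mult[OF assms] blinfun.diff_right blinfun.diff_left blinfun.minus_left flip: aff_elem_0[of S])
qed (simp_all add: aff_elem_carrier[OF assms])

text \<open>Since \<open>S x\<close> squares to zero, the inverse of \<open>id + S x\<close> is
  \<open>id - S x\<close>, that is, \<open>2 id\<close> minus the given linear part. Inversion on
  the group is therefore the restriction of a quadratic map of all pairs.\<close>

lemma inv_extension_aff_elem:
  assumes "abelian_tensor S"
  shows "(\<lambda>h. (2 *\<^sub>R id_blinfun - fst h, fst h (snd h) - 2 *\<^sub>R snd h)) (aff_elem S x) =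
    inv\<^bsub>G\<^esub> (aff_elem S x)"
  unfolding aff_elem_inv[OF assms]
  using abelian_tensorD[OF assms]
  by (simp add: aff_elem_def scaleR_2 blinfun.add_left blinfun.diff_right)

lemma subgroup_aff_group:
  assumes "abelian_tensor S"
  shows "subgroup (topspace (aff_group S)) G"
  using aff_elem_carrier[OF assms] aff_elem_mult[OF assms] aff_elem_inv[OF assms]
  by (intro group.subgroupI[OF group_G]) (auto simp: aff_group_def)

section \<open>The smooth structure of the group\<close>

lemma aff_elem_affine: "aff_elem S y = (S y, y) + (id_blinfun, 0)"
  by (simp add: aff_elem_def add.commute)

lemma bounded_linear_graph: "bounded_linear (\<lambda>y. (blinfun_apply S y, y))"
  by (intro bounded_linear_intros)

lemma smooth_on_aff_elem: "smooth_on UNIV (aff_elem S)"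
  unfolding aff_elem_affine[abs_def] by (intro smooth_on_affine bounded_linear_graph)

lemma smooth_on_mult_G:
  "smooth_on UNIV (\<lambda>(g, h). g \<otimes>\<^bsub>G\<^esub> h)"
proof (rule smooth_on_affine_derivative)
  fix p :: "'a aff \<times> 'a aff"
  show "((\<lambda>(g, h). g \<otimes>\<^bsub>G\<^esub> h) has_derivative
      (\<lambda>v. ((fst (fst p) o\<^sub>L fst (snd v)) + (fst (fst v) o\<^sub>L fst (snd p)),
        fst (fst p) (snd (snd v)) + fst (fst v) (snd (snd p)) + snd (fst v)))) (at p)"
    unfolding case_prod_beta mult_G_eq
    by (auto intro!: derivative_eq_intros bounded_bilinear.FDERIV[OF bounded_bilinear_blinfun_compose])
next
  fix v :: "'a aff \<times> 'a aff"
  have "bounded_linear (\<lambda>p :: 'a aff \<times> 'a aff.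
      ((fst (fst p) o\<^sub>L fst (snd v)) + (fst (fst v) o\<^sub>L fst (snd p)),
        fst (fst p) (snd (snd v)) + fst (fst v) (snd (snd p))))"
    by (intro bounded_linear_intros)
  then show "\<exists>l c. bounded_linear l \<and> (\<forall>p :: 'a aff \<times> 'a aff.
      ((fst (fst p) o\<^sub>L fst (snd v)) + (fst (fst v) o\<^sub>L fst (snd p)),
        fst (fst p) (snd (snd v)) + fst (fst v) (snd (snd p)) + snd (fst v)) = l p + c)"
    \<comment> \<open>The constant comes from the summand \<open>snd g\<close> of the product; all
      other terms of the derivative in direction \<open>v\<close> are linear in
      \<open>p\<close>.\<close>
    by (intro exI[of _ "\<lambda>p :: 'a aff \<times> 'a aff. ((fst (fst p) o\<^sub>L fst (snd v)) + (fst (fst v) o\<^sub>L fst (snd p)),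
        fst (fst p) (snd (snd v)) + fst (fst v) (snd (snd p)))"] exI[of _ "(0 :: 'a \<Rightarrow>\<^sub>L 'a, snd (fst v))"]) simp
qed

text \<open>A polynomial extension of the inversion of \<open>aff_group S\<close> to all pairs.\<close>

lemma smooth_on_inv_extension:
  "smooth_on UNIV (\<lambda>h :: 'a aff. (2 *\<^sub>R id_blinfun - fst h, blinfun_apply (fst h) (snd h) - 2 *\<^sub>R snd h))"
proof (rule smooth_on_affine_derivative)
  fix p :: "'a aff"
  show "((\<lambda>h. (2 *\<^sub>R id_blinfun - fst h, blinfun_apply (fst h) (snd h) - 2 *\<^sub>R snd h)) has_derivative
      (\<lambda>v. (- fst v :: 'a \<Rightarrow>\<^sub>L 'a, blinfun_apply (fst p) (snd v) + blinfun_apply (fst v) (snd p) - 2 *\<^sub>R snd v))) (at p)"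
    by (auto intro!: derivative_eq_intros)
next
  fix v :: "'a aff"
  have "bounded_linear (\<lambda>p :: 'a aff. (0 :: 'a \<Rightarrow>\<^sub>L 'a, blinfun_apply (fst p) (snd v) + blinfun_apply (fst v) (snd p)))"
    by (intro bounded_linear_intros)
  then show "\<exists>l c. bounded_linear l \<and>
      (\<forall>p :: 'a aff. (- fst v :: 'a \<Rightarrow>\<^sub>L 'a, blinfun_apply (fst p) (snd v) + blinfun_apply (fst v) (snd p) - 2 *\<^sub>R snd v) = l p + c)"
    by (intro exI[of _ "\<lambda>p :: 'a aff. (0 :: 'a \<Rightarrow>\<^sub>L 'a, blinfun_apply (fst p) (snd v) + blinfun_apply (fst v) (snd p))"] exI[of _ "(- fst v :: 'a \<Rightarrow>\<^sub>L 'a, - 2 *\<^sub>R snd v)"]) simp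
qed

text \<open>One global chart suffices: subtracting the identity element carries the group onto the
  graph of \<open>S\<close>, a linear subspace.\<close>

lemma immersed_submanifold_aff_group: "immersed_submanifold (aff_group S)"
proof -
  define W where "W = range (\<lambda>y. (blinfun_apply S y, y))"
  define e :: "'a aff" where "e = (id_blinfun, 0)"
  have C: "range (aff_elem S) = (\<lambda>w. w + e) ` W"
    unfolding W_def e_def image_image by (rule image_cong) (simp_all add: aff_elem_affine)
  have "subspace W"
    unfolding W_def by (intro linear_subspace_image bounded_linear.linear[OF bounded_linear_graph]) simp
  moreover have "diffeomorphism (top_of_set (range (aff_elem S))) (top_of_set W) (\<lambda>h. h + - e)"
    unfolding diffeomorphism_def
  proof (intro conjI exI[of _ "\<lambda>w. w + e"])
    show "smooth_map (top_of_set (range (aff_elem S))) (top_of_set W) (\<lambda>h. h + - e)"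
      by (rule smooth_map_top_of_setI[OF smooth_on_affine[OF bounded_linear_ident]]) (auto simp: C)
    show "smooth_map (top_of_set W) (top_of_set (range (aff_elem S))) (\<lambda>w. w + e)"
      by (rule smooth_map_top_of_setI[OF smooth_on_affine[OF bounded_linear_ident]]) (auto simp: C)
  qed auto
  ultimately show ?thesis
    unfolding immersed_submanifold_def aff_group_def
    by (intro exI[of _ W] conjI ballI exI[of _ "range (aff_elem S)"] exI[of _ W] exI[of _ "\<lambda>h. h + - e"])
      (auto simp: subtopology_subtopology)
qed

text \<open>The orbit map is the linear projection \<open>snd\<close>, and its inverse is the affine
  map \<open>aff_elem S\<close>.\<close>

lemma simply_transitive_aff_group: "simply_transitive (aff_group S)"
  unfolding simply_transitive_def diffeomorphism_def orbit_map_eq_snd aff_group_def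
proof (intro conjI exI[of _ "aff_elem S"])
  show "smooth_map (top_of_set (range (aff_elem S))) euclidean (snd :: 'a aff \<Rightarrow> 'a)"
    using smooth_map_top_of_setI[OF smooth_on_affine[OF bounded_linear_snd, of UNIV 0], of _ snd UNIV]
    by simp
  show "smooth_map euclidean (top_of_set (range (aff_elem S))) (aff_elem S)"
    using smooth_map_top_of_setI[OF smooth_on_aff_elem, of UNIV] by auto
qed auto

lemma lie_subgroup_aff_group:
  assumes "abelian_tensor S"
  shows "lie_subgroup G (aff_group S)"
  unfolding lie_subgroup_def
proof (intro conjI subgroup_aff_group[OF assms] immersed_submanifold_aff_group)
  let ?C = "range (aff_elem S)"
  have "prod_topology (top_of_set ?C) (top_of_set ?C) = top_of_set (?C \<times> ?C)"
    by (simp add: subtopology_Times)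
  moreover have "smooth_map (top_of_set (?C \<times> ?C)) (top_of_set ?C) (\<lambda>(g, h). g \<otimes>\<^bsub>G\<^esub> h)"
    by (rule smooth_map_top_of_setI[OF smooth_on_mult_G]) (auto simp: aff_elem_mult[OF assms])
  ultimately show "smooth_map (prod_topology (aff_group S) (aff_group S)) (aff_group S) (\<lambda>(g, h). g \<otimes>\<^bsub>G\<^esub> h)"
    by (simp add: aff_group_def)
  show "smooth_map (aff_group S) (aff_group S) (\<lambda>h. inv\<^bsub>G\<^esub> h)"
    unfolding aff_group_def
    by (rule smooth_map_top_of_setI[OF smooth_on_inv_extension])
      (use inv_extension_aff_elem[OF assms] in \<open>auto simp: aff_elem_inv[OF assms]\<close>)
qed

lemma aff_group_in_groups:
  assumes "abelian_tensor S"
  shows "aff_group S \<in> abelian_simply_transitive_groups \<omega>"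
proof -
  have "connected (range (aff_elem S))"
    by (intro connected_continuous_image smooth_on_imp_continuous_on smooth_on_aff_elem connected_UNIV)
  then have "connected_space (aff_group S)"
    by (simp add: aff_group_def connected_space_subtopology)
  moreover have "comm_group (G\<lparr>carrier := topspace (aff_group S)\<rparr>)"
  proof (rule group.group_comm_groupI)
    show "group (G\<lparr>carrier := topspace (aff_group S)\<rparr>)"
      by (rule subgroup.subgroup_is_group[OF subgroup_aff_group[OF assms] group_G])
  next
    fix g h
    assume "g \<in> carrier (G\<lparr>carrier := topspace (aff_group S)\<rparr>)"
      "h \<in> carrier (G\<lparr>carrier := topspace (aff_group S)\<rparr>)"
    then obtain x y where "g = aff_elem S x" "h = aff_elem S y"
      by (auto simp: aff_group_def)
    then show "g \<otimes>\<^bsub>G\<lparr>carrier := topspace (aff_group S)\<rparr>\<^esub> h = h \<otimes>\<^bsub>G\<lparr>carrier := topspace (aff_group S)\<rparr>\<^esub> g"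
      using abelian_tensorD(1)[OF assms, of x y] by (simp add: aff_elem_mult[OF assms] add.commute)
  qed
  ultimately show ?thesis
    by (simp add: abelian_simply_transitive_groups_def affine_group_symplectic_type_def
        lie_subgroup_aff_group[OF assms] simply_transitive_aff_group)
qed

section \<open>Classification: every Abelian simply transitive group comes from a tensor\<close>

lemma abelian_simply_transitive_group_cases:
  assumes "H \<in> abelian_simply_transitive_groups \<omega>"
  obtains S where "abelian_tensor S" "H = aff_group S"
proof -
  have sub: "subgroup (topspace H) G" and comm: "comm_group (G\<lparr>carrier := topspace H\<rparr>)"
    and st: "diffeomorphism H euclidean (snd :: 'a aff \<Rightarrow> 'a)"
    using assms unfolding abelian_simply_transitive_groups_def affine_group_symplectic_type_def
      lie_subgroup_def simply_transitive_def orbit_map_eq_snd by auto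
  \<comment> \<open>\<open>h\<close> is the inverse of the orbit map: \<open>h y\<close> is the
    unique element of \<open>H\<close> with translational part \<open>y\<close>.\<close>
  obtain h where h: "smooth_map euclidean H h" "\<And>g. g \<in> topspace H \<Longrightarrow> h (snd g) = g" "\<And>y. snd (h y) = y"
    using st unfolding diffeomorphism_def by auto
  have snd_H: "continuous_map H euclidean (snd :: 'a aff \<Rightarrow> 'a)"
    using st unfolding diffeomorphism_def smooth_map_def by blast
  have h_cont: "continuous_map euclidean H h"
    using h(1) by (simp add: smooth_map_def)
  have h_in: "h y \<in> topspace H" for y
    using continuous_map_image_subset_topspace[OF h_cont] by auto
  define A where "A y = fst (h y)" for y
  have hA: "h y = (A y, y)" for y
    using h(3)[of y] by (simp add: A_def prod_eq_iff)
  have h0: "h 0 = (id_blinfun, 0)"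
    using h(2)[OF subgroup.one_closed[OF sub]] by (simp add: one_G)
  have A0: "A 0 = id_blinfun"
    using h0 by (simp add: A_def)
  have AA: "(A x o\<^sub>L A y, A x y + x) \<in> topspace H" for x y
    using subgroup.m_closed[OF sub h_in[of x] h_in[of y]] by (simp add: hA mult_G)
  \<comment> \<open>An element of \<open>H\<close> is recovered from its translational part, so the
    linear part of the product \<open>h x\<close> times \<open>h y\<close> is the value of
    \<open>A\<close> at the translational part of that product.\<close>
  have A_mult: "A (A x y + x) = A x o\<^sub>L A y" for x y
    using h(2)[OF AA[of x y]] by (simp add: hA)
  have A_comm: "A x y + x = A y x + y" for x y
  proof -
    have "h x \<otimes>\<^bsub>G\<lparr>carrier := topspace H\<rparr>\<^esub> h y = h y \<otimes>\<^bsub>G\<lparr>carrier := topspace H\<rparr>\<^esub> h x"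
      using h_in by (intro comm_monoid.m_comm[OF comm_group.axioms(1)[OF comm]]) simp_all
    then show ?thesis
      by (simp add: hA mult_G)
  qed
  have A_symp: "A x \<in> symplectic_group \<omega>" for x
    using subgroup.subset[OF sub] h_in[of x] by (auto simp: hA carrier_G)
  \<comment> \<open>Smoothness of \<open>h\<close> is given through a local extension; as it agrees
    with \<open>h\<close> on an open neighbourhood of 0, \<open>h\<close> is differentiable
    there.\<close>
  obtain N B F where F: "open N" "0 \<in> N" "N \<subseteq> B" "smooth_on B F" "\<And>x. x \<in> N \<Longrightarrow> F x = h x"
    using h(1) unfolding smooth_map_def by (auto dest!: spec[of _ 0])
  have "higher_differentiable_on (Suc 0) B F"
    using F(4) unfolding smooth_on_def by blast
  then obtain F' where "(F has_derivative F') (at 0)"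
    using F(2,3) unfolding higher_differentiable_on.simps differentiable_def by blast
  then have "(h has_derivative F') (at 0)"
    using F(1,2,5) by (rule has_derivative_transform_within_open)
  then have A_deriv: "(A has_derivative (\<lambda>v. fst (F' v))) (at 0)"
    unfolding A_def by (rule has_derivative_fst)
  define S where "S = Blinfun (\<lambda>v. fst (F' v))"
  have S: "(A has_derivative blinfun_apply S) (at 0)"
    using A_deriv has_derivative_bounded_linear[OF A_deriv]
    by (simp add: S_def bounded_linear_Blinfun_apply)
  \<comment> \<open>Both sides of \<open>A_comm\<close> are differentiated in \<open>y\<close> at 0.
    One is affine in \<open>y\<close>, the other has derivative \<open>S v x + v\<close>; so
    \<open>A x v\<close> is affine in \<open>x\<close>.\<close>
  have A_eq: "A x v = S v x + v" for x v
  proof -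
    have "((\<lambda>y. A y x + y) has_derivative (\<lambda>v. S v x + v)) (at 0)"
      using S by (auto intro!: derivative_eq_intros)
    moreover have "((\<lambda>y. A x y + x) has_derivative (\<lambda>v. A x v)) (at 0)"
      by (auto intro!: derivative_eq_intros)
    ultimately show ?thesis
      unfolding A_comm[of x] by (metis has_derivative_unique)
  qed
  \<comment> \<open>The derivative of \<open>A x y\<close> in \<open>x\<close> is computed twice,
    from the definition of \<open>S\<close> and from the affine formula \<open>A_eq\<close>.\<close>
  have S_sym: "blinfun_apply (S x) y = S y x" for x y
  proof -
    have "((\<lambda>x. A x y) has_derivative (\<lambda>v. S v y)) (at 0)"
      using S by (auto intro!: derivative_eq_intros)
    moreover have "((\<lambda>x. A x y) has_derivative (\<lambda>v. S y v)) (at 0)"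
      unfolding A_eq by (auto intro!: derivative_eq_intros)
    ultimately show ?thesis
      by (metis has_derivative_unique)
  qed
  have A_S: "A x = id_blinfun + S x" for x
    by (rule blinfun_eqI) (simp add: A_eq blinfun.add_left S_sym[of x])
  \<comment> \<open>As \<open>A x y + x = x + y + S x y\<close>, expanding \<open>A_mult\<close> and
    cancelling the terms linear in \<open>S\<close> leaves the quadratic ones.\<close>
  have S_mult: "S (S x y) z = S x (S y z)" for x y z
    using arg_cong[OF A_mult[of x y], of "\<lambda>T. blinfun_apply T z"]
    by (simp add: A_S blinfun.add_left blinfun.add_right)
  have skew: "\<omega> (S x y) z = - \<omega> y (S x z)" for x y z
  proof -
    \<comment> \<open>Invariance of \<omega> under \<open>id + S x\<close> has parts linear and
      quadratic in \<open>x\<close>; comparison with \<open>- x\<close> isolates the linear part,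
      which is skewness.\<close>
    have "\<omega> (S x y) z + \<omega> y (S x z) + \<omega> (S x y) (S x z) = 0" for x
      using symplectic_groupD[OF A_symp[of x], of y z]
      by (simp add: A_S blinfun.add_left form_simps)
    from this[of x] this[of "- x"] show ?thesis
      by (simp add: blinfun.minus_right blinfun.minus_left form_simps)
  qed
  \<comment> \<open>Moving two skew operators across \<omega> reverses their order. By
    \<open>S_mult\<close> and symmetry the reversed product is the single skew operator
    \<open>S (S x y)\<close>, so the value equals its own negative.\<close>
  have "S x (S y z) = 0" for x y z
  proof (rule form_eqI)
    fix w
    have "\<omega> (S x (S y z)) w = \<omega> z (S y (S x w))"
      by (simp add: skew form_simps)
    also have "S y (S x w) = S (S x y) w"
      by (metis S_mult S_sym)
    also have "\<omega> z (S (S x y) w) = - \<omega> (S (S x y) z) w"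
      by (simp add: skew)
    finally show "\<omega> (S x (S y z)) w = \<omega> 0 w"
      by (simp add: S_mult form_simps)
  qed
  then have "abelian_tensor S"
    using S_sym skew unfolding abelian_tensor_def prolongation_tensor_def by blast
  moreover have "H = aff_group S"
  proof -
    have h_eq: "h = aff_elem S"
      by (rule ext) (simp add: hA A_S aff_elem_def)
    have "topspace H = range (aff_elem S)"
      using h(2) h_in unfolding h_eq by (metis image_eqI image_subset_iff rangeI subsetI subset_antisym UNIV_I)
    then have top: "topspace H = topspace (aff_group S)"
      by (simp add: aff_group_def)
    \<comment> \<open>Equality of \<open>H\<close> and \<open>aff_group S\<close> includes their
      topologies. The identity is continuous in both directions because it factors through the
      vector space as \<open>snd\<close> followed by \<open>aff_elem S\<close>.\<close>
    have "continuous_map (aff_group S) H (aff_elem S \<circ> snd)"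
      using h_cont[unfolded h_eq] unfolding aff_group_def
      by (intro continuous_map_compose[of _ euclidean]) (auto intro: continuous_on_snd)
    then have "continuous_map (aff_group S) H id"
      by (rule continuous_map_eq) (auto simp: aff_group_def)
    moreover have "continuous_map H (aff_group S) (aff_elem S \<circ> snd)"
      using smooth_on_imp_continuous_on[OF smooth_on_aff_elem]
      by (intro continuous_map_compose[OF snd_H]) (auto simp: aff_group_def continuous_map_in_subtopology)
    then have "continuous_map H (aff_group S) id"
      by (rule continuous_map_eq) (auto simp: top aff_group_def)
    ultimately have "homeomorphic_map H (aff_group S) id"
      unfolding homeomorphic_map_maps homeomorphic_maps_def by (intro exI[of _ id]) auto
    then show ?thesis
      by (simp add: homeomorphic_map_id)
  qed
  ultimately show thesis
    by (rule that)
qed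

section \<open>The Lie algebra and the tensor read off from it\<close>

lemma lie_algebra_aff_group: "lie_algebra G (aff_group S) = range (\<lambda>v. (blinfun_apply S v, v))"
proof (intro subset_antisym subsetI)
  fix v assume "v \<in> lie_algebra G (aff_group S)"
  then obtain \<gamma> :: "real \<Rightarrow> 'a aff" where \<gamma>: "smooth_map euclidean (aff_group S) \<gamma>" "(\<gamma> has_vector_derivative v) (at 0)"
    unfolding lie_algebra_def by blast
  have "continuous_map euclidean (aff_group S) \<gamma>"
    using \<gamma>(1) by (simp add: smooth_map_def)
  from continuous_map_image_subset_topspace[OF this] have "\<gamma> t \<in> range (aff_elem S)" for t
    by (auto simp: aff_group_def)
  then have "\<gamma> t = aff_elem S (snd (\<gamma> t))" for t
    by (metis rangeE snd_aff_elem)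
  \<comment> \<open>A curve in the group is determined by its translational part, so its velocity
    lies in the graph of \<open>S\<close>.\<close>
  then have \<gamma>_eq: "\<gamma> = (\<lambda>t. (S (snd (\<gamma> t)), snd (\<gamma> t)) + (id_blinfun, 0))"
    by (metis aff_elem_affine)
  have "((\<lambda>t. snd (\<gamma> t)) has_vector_derivative snd v) (at 0)"
    by (rule bounded_linear.has_vector_derivative[OF bounded_linear_snd \<gamma>(2)])
  from bounded_linear.has_vector_derivative[OF bounded_linear_graph[of S] this]
  have "((\<lambda>t. (S (snd (\<gamma> t)), snd (\<gamma> t)) + (id_blinfun, 0)) has_vector_derivative (S (snd v), snd v)) (at 0)"
    by (subst has_vector_derivative_add_const)
  from this[folded \<gamma>_eq] have "v = (S (snd v), snd v)"
    by (rule vector_derivative_unique_at[OF \<gamma>(2)])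
  then show "v \<in> range (\<lambda>v. (S v, v))"
    by blast
next
  fix v assume "v \<in> range (\<lambda>v. (blinfun_apply S v, v))"
  then obtain X where v: "v = (S X, X)"
    by blast
  have l: "bounded_linear (\<lambda>t. t *\<^sub>R v)"
    by (rule bounded_linear_scaleR_left)
  \<comment> \<open>Conversely the straight line through the identity in a graph direction stays in
    the group.\<close>
  have eq: "t *\<^sub>R v + (id_blinfun, 0) = aff_elem S (t *\<^sub>R X)" for t
    by (simp add: v aff_elem_affine blinfun.scaleR_right)
  have "smooth_map euclidean (aff_group S) (\<lambda>t. t *\<^sub>R v + (id_blinfun, 0))"
    using smooth_map_top_of_setI[OF smooth_on_affine[OF l], of UNIV "(id_blinfun, 0)" "\<lambda>t. t *\<^sub>R v + (id_blinfun, 0)" "range (aff_elem S)"]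
    by (auto simp: aff_group_def eq)
  moreover have "((\<lambda>t. t *\<^sub>R v + (id_blinfun, 0)) has_vector_derivative v) (at 0)"
    by (auto intro!: derivative_eq_intros)
  ultimately show "v \<in> lie_algebra G (aff_group S)"
    unfolding lie_algebra_def by (force simp: one_G)
qed

lemma S_lin_aff_group: "S_lin \<omega> (aff_group S) X = S X"
proof -
  have "frechet_derivative orbit_map (at \<one>\<^bsub>G\<^esub>) = (snd :: 'a aff \<Rightarrow> 'a)"
    unfolding orbit_map_eq_snd
    by (rule frechet_derivative_at[symmetric]) (rule bounded_linear_imp_has_derivative[OF bounded_linear_snd])
  moreover have "inv_into (range (\<lambda>v. (blinfun_apply S v, v))) snd X = (S X, X)"
    by (rule inv_into_f_eq) (auto simp: inj_on_def)
  ultimately show ?thesis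
    by (simp add: S_lin_def lie_algebra_aff_group)
qed

section \<open>Conjugacy\<close>

text \<open>The translation \<open>b\<close> enters only the translational part of the conjugate;
  the linear part sees \<open>A\<close> alone.\<close>

lemma conjugate_aff_elem:
  assumes "A \<in> symplectic_group \<omega>" "B \<in> symplectic_group \<omega>" "B o\<^sub>L A = id_blinfun" "A o\<^sub>L B = id_blinfun"
  shows "(A, b) \<otimes>\<^bsub>G\<^esub> aff_elem S y \<otimes>\<^bsub>G\<^esub> inv\<^bsub>G\<^esub> (A, b) = (id_blinfun + (A o\<^sub>L S y o\<^sub>L B), A (y - S y (B b)))"
proof -
  have "A (B x) = x" for x
    using assms(4) by (metis blinfun_apply_id_blinfun blinfun_compose.rep_eq comp_apply id_apply)
  then show ?thesis
    by (auto simp: inv_G[OF assms(1-3)] mult_G aff_elem_def blinfun.add_left blinfun.add_right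
        blinfun.diff_right blinfun.minus_right intro!: blinfun_eqI)
qed

text \<open>For bijective \<open>A\<close> this says that \<open>A\<close> is an isomorphism between
  the algebras with products \<open>S x y\<close> and \<open>S' x y\<close>.\<close>

definition intertwines :: "('a \<Rightarrow>\<^sub>L 'a) \<Rightarrow> ('a \<Rightarrow>\<^sub>L 'a \<Rightarrow>\<^sub>L 'a) \<Rightarrow> ('a \<Rightarrow>\<^sub>L 'a \<Rightarrow>\<^sub>L 'a) \<Rightarrow> bool" where
  "intertwines A S S' \<longleftrightarrow> (\<forall>x y. S' (A x) (A y) = A (S x y))"

lemma continuous_on_conjugation: "continuous_on UNIV (\<lambda>h. g \<otimes>\<^bsub>G\<^esub> h \<otimes>\<^bsub>G\<^esub> k)"
  unfolding mult_G_eq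
  by (auto intro!: continuous_intros bounded_bilinear.continuous_on[OF bounded_bilinear_blinfun_compose])

lemma conjugation_continuous_map:
  assumes "A \<in> symplectic_group \<omega>" and "intertwines A S S'"
  shows "continuous_map (aff_group S) (aff_group S') (\<lambda>h. (A, 0) \<otimes>\<^bsub>G\<^esub> h \<otimes>\<^bsub>G\<^esub> inv\<^bsub>G\<^esub> (A, 0))"
proof -
  obtain B where B: "B \<in> symplectic_group \<omega>" "\<And>x. A (B x) = x"
    "A o\<^sub>L B = id_blinfun" "B o\<^sub>L A = id_blinfun"
    using symplectic_group_inverse[OF assms(1)] by metis
  have "A o\<^sub>L S y o\<^sub>L B = S' (A y)" for y
    by (rule blinfun_eqI) (metis B(2) assms(2) blinfun_compose.rep_eq comp_apply intertwines_def)
  then have "(A, 0) \<otimes>\<^bsub>G\<^esub> aff_elem S y \<otimes>\<^bsub>G\<^esub> inv\<^bsub>G\<^esub> (A, 0) = aff_elem S' (A y)" for y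
    unfolding conjugate_aff_elem[OF assms(1) B(1,4,3)]
    by (simp add: aff_elem_def blinfun.zero_right)
  then show ?thesis
    using continuous_on_subset[OF continuous_on_conjugation]
    by (auto simp: aff_group_def continuous_map_in_subtopology)
qed

text \<open>Conjugation by a translation only reparametrizes the group, so the linear part of a
  conjugating element intertwines. Conversely an intertwining \<open>A\<close> gives conjugation by
  \<open>(A, 0)\<close>, whose inverse is conjugation by the inverse of \<open>A\<close>.\<close>

lemma aff_conjugate_iff:
  assumes "abelian_tensor S"
  shows "aff_conjugate \<omega> (aff_group S) (aff_group S') \<longleftrightarrow> (\<exists>A\<in>symplectic_group \<omega>. intertwines A S S')"
proof
  assume "aff_conjugate \<omega> (aff_group S) (aff_group S')"
  then obtain A b where A: "A \<in> symplectic_group \<omega>"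
    and hom: "homeomorphic_map (aff_group S) (aff_group S') (\<lambda>h. (A, b) \<otimes>\<^bsub>G\<^esub> h \<otimes>\<^bsub>G\<^esub> inv\<^bsub>G\<^esub> (A, b))"
    unfolding aff_conjugate_def carrier_G by blast
  obtain B where B: "B \<in> symplectic_group \<omega>" "\<And>x. B (A x) = x"
    "A o\<^sub>L B = id_blinfun" "B o\<^sub>L A = id_blinfun"
    using symplectic_group_inverse[OF A] by metis
  have "S' (A z) = A o\<^sub>L S z o\<^sub>L B" for z
  proof -
    \<comment> \<open>The added term compensates the shift by \<open>S y (B b)\<close> and leaves
      \<open>S\<close> unchanged, because \<open>S\<close> vanishes on its own values.\<close>
    define y where "y = z + S z (B b)"
    have "S y = S z"
      by (simp add: y_def blinfun.add_right abelian_tensorD(4)[OF assms])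
    then have "y - S y (B b) = z"
      by (simp add: y_def)
    then have "(A, b) \<otimes>\<^bsub>G\<^esub> aff_elem S y \<otimes>\<^bsub>G\<^esub> inv\<^bsub>G\<^esub> (A, b) = (id_blinfun + (A o\<^sub>L S z o\<^sub>L B), A z)"
      unfolding conjugate_aff_elem[OF A B(1,4,3)] \<open>S y = S z\<close> by simp
    moreover have "(A, b) \<otimes>\<^bsub>G\<^esub> aff_elem S y \<otimes>\<^bsub>G\<^esub> inv\<^bsub>G\<^esub> (A, b) \<in> topspace (aff_group S')"
      unfolding homeomorphic_imp_surjective_map[OF hom, symmetric] by (auto simp: aff_group_def)
    ultimately show ?thesis
      by (auto simp: aff_group_def aff_elem_def)
  qed
  then have "intertwines A S S'"
    by (simp add: intertwines_def B(2))
  with A show "\<exists>A\<in>symplectic_group \<omega>. intertwines A S S'"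
    by blast
next
  assume "\<exists>A\<in>symplectic_group \<omega>. intertwines A S S'"
  then obtain A where A: "A \<in> symplectic_group \<omega>" "intertwines A S S'"
    by blast
  obtain B where B: "B \<in> symplectic_group \<omega>" "\<And>x. A (B x) = x" "\<And>x. B (A x) = x"
    "A o\<^sub>L B = id_blinfun" "B o\<^sub>L A = id_blinfun"
    using symplectic_group_inverse[OF A(1)] by metis
  have "intertwines B S' S"
    unfolding intertwines_def using A(2)[unfolded intertwines_def] B(2,3) by metis
  note c = conjugation_continuous_map[OF A] conjugation_continuous_map[OF B(1) this]
  have cancel: "(B, 0) \<otimes>\<^bsub>G\<^esub> ((A, 0) \<otimes>\<^bsub>G\<^esub> h \<otimes>\<^bsub>G\<^esub> inv\<^bsub>G\<^esub> (A, 0)) \<otimes>\<^bsub>G\<^esub> inv\<^bsub>G\<^esub> (B, 0) = h"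
    "(A, 0) \<otimes>\<^bsub>G\<^esub> ((B, 0) \<otimes>\<^bsub>G\<^esub> h \<otimes>\<^bsub>G\<^esub> inv\<^bsub>G\<^esub> (B, 0)) \<otimes>\<^bsub>G\<^esub> inv\<^bsub>G\<^esub> (A, 0) = h" for h
    using B(2,3)
    by (auto simp: inv_G[OF A(1) B(1) B(5)] inv_G[OF B(1) A(1) B(4)] mult_G_eq
        blinfun.zero_right prod_eq_iff intro!: blinfun_eqI)
  have "homeomorphic_map (aff_group S) (aff_group S') (\<lambda>h. (A, 0) \<otimes>\<^bsub>G\<^esub> h \<otimes>\<^bsub>G\<^esub> inv\<^bsub>G\<^esub> (A, 0))"
    unfolding homeomorphic_map_maps homeomorphic_maps_def using c cancel by blast
  then show "aff_conjugate \<omega> (aff_group S) (aff_group S')"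
    unfolding aff_conjugate_def using A(1) by (force simp: carrier_G)
qed

section \<open>Tensors and trilinear forms\<close>

definition flat :: "'a \<Rightarrow> 'a dual" where
  "flat x = Blinfun (\<lambda>u. \<omega> u x)"

lemma flat_apply [simp]: "flat x u = \<omega> u x"
  using linear_form_left[of x] by (simp add: flat_def bounded_linear_Blinfun_apply linear_conv_bounded_linear)

lemma lower_indices_eq: "lower_indices \<omega> T X Y Z = T (flat X) (flat Y) (flat Z)"
  by (simp add: lower_indices_def flat_def)

lemma flat_surj:
  fixes \<alpha> :: "'a dual"
  obtains x where "\<alpha> = flat x"
proof -
  obtain J where J: "\<And>x y. \<omega> x (J y) = x \<bullet> y"
    using form_inner_isomorphism by metis
  have "\<alpha> = flat (J (\<Sum>i\<in>Basis. \<alpha> i *\<^sub>R i))"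
  proof (rule blinfun_eqI)
    fix x
    have "\<alpha> x = \<alpha> (\<Sum>i\<in>Basis. (x \<bullet> i) *\<^sub>R i)"
      by (simp add: euclidean_representation)
    then show "\<alpha> x = flat (J (\<Sum>i\<in>Basis. \<alpha> i *\<^sub>R i)) x"
      by (simp add: J blinfun.sum_right blinfun.scaleR_right inner_sum_right mult.commute)
  qed
  with that show thesis
    by blast
qed

lemma lower_indices_inject:
  assumes "\<And>X Y Z. lower_indices \<omega> T X Y Z = lower_indices \<omega> T' X Y Z"
  shows "T = T'"
proof (intro blinfun_eqI)
  fix \<alpha> \<beta> \<gamma> :: "'a dual"
  show "T \<alpha> \<beta> \<gamma> = T' \<alpha> \<beta> \<gamma>"
    by (rule flat_surj[of \<alpha>], rule flat_surj[of \<beta>], rule flat_surj[of \<gamma>])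
      (use assms in \<open>simp add: lower_indices_eq\<close>)
qed

text \<open>Lowering indices is \<open>Sp(V)\<close>-equivariant because pulling
  \<open>flat (g X)\<close> back along a symplectic \<open>g\<close> gives
  \<open>flat X\<close>.\<close>

lemma lower_indices_tensor_map:
  assumes "g \<in> symplectic_group \<omega>"
  shows "lower_indices \<omega> (tensor_map g T) (g X) (g Y) (g Z) = lower_indices \<omega> T X Y Z"
proof -
  have "flat (g X) o\<^sub>L g = flat X" for X
    by (rule blinfun_eqI) (simp add: symplectic_groupD[OF assms])
  then show ?thesis
    by (simp add: lower_indices_eq)
qed

lemma lower_indices_linear:
  "lower_indices \<omega> 0 X Y Z = 0"
  "lower_indices \<omega> (T + T') X Y Z = lower_indices \<omega> T X Y Z + lower_indices \<omega> T' X Y Z"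
  "lower_indices \<omega> (c *\<^sub>R T) X Y Z = c * lower_indices \<omega> T X Y Z"
  by (simp_all add: lower_indices_eq blinfun.add_left blinfun.scaleR_left blinfun.zero_left)

lemma lower_indices_sum: "lower_indices \<omega> (\<Sum>i\<in>I. T i) X Y Z = (\<Sum>i\<in>I. lower_indices \<omega> (T i) X Y Z)"
  by (simp add: lower_indices_eq blinfun.sum_left)

lemma lower_indices_sym_prod:
  "lower_indices \<omega> (sym_prod u v w) X Y Z = (1 / 6) *
    (\<omega> u X * \<omega> v Y * \<omega> w Z + \<omega> u X * \<omega> w Y * \<omega> v Z + \<omega> v X * \<omega> u Y * \<omega> w Z +
     \<omega> v X * \<omega> w Y * \<omega> u Z + \<omega> w X * \<omega> u Y * \<omega> v Z + \<omega> w X * \<omega> v Y * \<omega> u Z)"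
  by (simp add: sym_prod_def lower_indices_linear lower_indices_tensor_prod[OF symplectic])

section \<open>Symmetric tensors and prolongation tensors\<close>

definition represents :: "'a tensor3 \<Rightarrow> ('a \<Rightarrow>\<^sub>L 'a \<Rightarrow>\<^sub>L 'a) \<Rightarrow> bool" where
  "represents T S \<longleftrightarrow> (\<forall>X Y Z. lower_indices \<omega> T X Y Z = \<omega> (S X Y) Z)"

text \<open>If \<open>S\<close> takes values in \<open>L\<close>, its symmetric trilinear form
  depends on each argument only through the pairing with \<open>L\<close>. Expanded in a basis
  \<open>B\<close> of \<open>L\<close>, the form is a combination of products of such pairings,
  which is a tensor in \<open>S^3 L\<close>.\<close>

lemma represents_exists:
  assumes S: "prolongation_tensor S" and L: "subspace L" "\<And>X Y. S X Y \<in> L"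
  obtains T where "T \<in> sym3 L" "represents T S"
proof -
  obtain J where J: "linear J" "\<And>x y. \<omega> x (J y) = x \<bullet> y"
    using form_inner_isomorphism by metis
  obtain B where B: "finite B" "B \<subseteq> L" "\<And>x. x \<in> L \<Longrightarrow> (\<Sum>b\<in>B. (x \<bullet> b) *\<^sub>R b) = x"
    using orthonormal_expansion_subspace[OF L(1)] by metis
  define t where "t X Y Z = \<omega> (S X Y) Z" for X Y Z
  have t12: "t X Y Z = t Y X Z" and t23: "t X Y Z = t X Z Y" for X Y Z
    using prolongation_tensorD[OF S] form_skew[of Y] by (simp_all add: t_def)
  have t13: "t X Y Z = t Z Y X" for X Y Z
    by (metis t12 t23)
  \<comment> \<open>\<open>Q X\<close> has the same pairing with \<open>L\<close> as
    \<open>X\<close> but lies in the span of the vectors \<open>J b\<close>, which are dual to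
    \<open>B\<close> under \<omega>.\<close>
  define Q where "Q X = (\<Sum>b\<in>B. \<omega> b X *\<^sub>R J b)" for X
  have tQ: "t X Y (Q Z) = t X Y Z" for X Y Z
  proof -
    have "\<omega> x (Q Z) = \<omega> x Z" if "x \<in> L" for x
    proof -
      have "\<omega> x (Q Z) = \<omega> (\<Sum>b\<in>B. (x \<bullet> b) *\<^sub>R b) Z"
        by (simp add: Q_def linear_sum[OF linear_form_left] linear_sum[OF linear_form_right]
            form_simps J(2) mult.commute)
      then show ?thesis
        by (simp add: B(3)[OF that])
    qed
    then show ?thesis
      by (simp add: t_def L(2))
  qed
  have tQQQ: "t (Q X) (Q Y) (Q Z) = t X Y Z" for X Y Z
    by (metis t12 t23 tQ)
  define C where "C a b c = t (J a) (J b) (J c)" for a b c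
  define T where "T = (\<Sum>a\<in>B. \<Sum>b\<in>B. \<Sum>c\<in>B. C a b c *\<^sub>R sym_prod a b c)"
  \<comment> \<open>The weights \<open>C\<close> are symmetric, so permuting the arguments of
    \<open>f\<close> does not change the sum. Hence the six terms of each \<open>sym_prod\<close>
    contribute equally and cancel the factor 1/6.\<close>
  define M where "M f = (\<Sum>a\<in>B. \<Sum>b\<in>B. \<Sum>c\<in>B. C a b c * f a b c)" for f :: "'a \<Rightarrow> 'a \<Rightarrow> 'a \<Rightarrow> real"
  have M12: "M (\<lambda>a b c. f b a c) = M f" for f
  proof -
    have "M (\<lambda>a b c. f b a c) = (\<Sum>b\<in>B. \<Sum>a\<in>B. \<Sum>c\<in>B. C a b c * f b a c)"
      unfolding M_def by (rule sum.swap)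
    also have "\<dots> = M f"
      unfolding M_def C_def using t12 by (intro sum.cong refl) simp
    finally show ?thesis .
  qed
  have M23: "M (\<lambda>a b c. f a c b) = M f" for f
  proof -
    have "M (\<lambda>a b c. f a c b) = (\<Sum>a\<in>B. \<Sum>c\<in>B. \<Sum>b\<in>B. C a b c * f a c b)"
      unfolding M_def by (intro sum.cong refl sum.swap)
    also have "\<dots> = M f"
      unfolding M_def C_def using t23 by (intro sum.cong refl) simp
    finally show ?thesis .
  qed
  have "lower_indices \<omega> T X Y Z = t X Y Z" for X Y Z
  proof -
    define f where "f a b c = \<omega> a X * \<omega> b Y * \<omega> c Z" for a b c
    have "lower_indices \<omega> T X Y Z = M (\<lambda>a b c. (1 / 6) *
        (f a b c + f a c b + f b a c + f b c a + f c a b + f c b a))"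
      unfolding T_def M_def f_def lower_indices_sum lower_indices_linear lower_indices_sym_prod
      by (simp add: algebra_simps)
    also have "\<dots> = (1 / 6) * (M (\<lambda>a b c. f a b c) + M (\<lambda>a b c. f a c b) + M (\<lambda>a b c. f b a c)
        + M (\<lambda>a b c. f b c a) + M (\<lambda>a b c. f c a b) + M (\<lambda>a b c. f c b a))"
      unfolding M_def sum_distrib_left sum.distrib[symmetric]
      by (intro sum.cong refl) (simp add: algebra_simps)
    also have "\<dots> = M f"
      using M12[of "\<lambda>a b c. f a c b"] M23[of "\<lambda>a b c. f b a c"] M23[of "\<lambda>a b c. f b c a"]
        M23[of "\<lambda>a b c. f c a b"] M12[of "\<lambda>a b c. f c a b"] M12[of "\<lambda>a b c. f b c a"] M12[of f] M23[of f]
      by simp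
    \<comment> \<open>The arguments are reversed to match the expansion of
      \<open>t (Q Z) (Q Y) (Q X)\<close> by linearity; \<open>t13\<close> undoes the reversal
      afterwards.\<close>
    also have "\<dots> = (\<Sum>a\<in>B. \<Sum>b\<in>B. \<Sum>c\<in>B. t (J c) (J b) (J a) * f a b c)"
      unfolding M_def C_def by (intro sum.cong refl) (metis t13)
    also have "\<dots> = t (Q Z) (Q Y) (Q X)"
      by (simp add: f_def t_def Q_def blinfun.sum_left blinfun.sum_right blinfun.scaleR_left
          blinfun.scaleR_right linear_sum[OF linear_form_left] linear_sum[OF linear_form_right]
          form_simps sum_distrib_left mult_ac)
    also have "\<dots> = t X Y Z"
      by (metis t13 tQQQ)
    finally show ?thesis .
  qed
  then have "represents T S"
    by (simp add: represents_def t_def)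
  moreover have "T \<in> sym3 L"
    unfolding T_def sym3_def using B(2) by (intro span_sum span_scale span_base) blast
  ultimately show thesis
    using that by blast
qed

text \<open>The definite description in \<open>S_tensor\<close> is justified:
  \<open>represents_exists\<close> supplies a tensor, and injectivity of lowering indices makes it
  unique.\<close>

lemma S_tensor_aff_group:
  assumes "abelian_tensor S"
  shows "represents (S_tensor \<omega> (aff_group S)) S"
proof -
  obtain T where T: "T \<in> sym3 UNIV" "represents T S"
    using represents_exists[of S UNIV] assms by (auto simp: abelian_tensor_def)
  have "S_tensor \<omega> (aff_group S) = T"
    unfolding S_tensor_def S_lin_aff_group
    by (rule the_equality) (use T in \<open>auto simp: represents_def intro!: lower_indices_inject\<close>)
  with T(2) show ?thesis
    by simp
qed

lemma represents_unique: "represents T S \<Longrightarrow> represents T' S \<Longrightarrow> T = T'"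
  by (rule lower_indices_inject) (simp add: represents_def)

text \<open>Since \<open>A\<close> is surjective, both conditions can be tested on vectors
  \<open>A X\<close>, \<open>A Y\<close>, \<open>A Z\<close>, where they become the same equation by
  invariance and nondegeneracy of \<omega>.\<close>

lemma intertwines_iff_tensor_map:
  assumes A: "A \<in> symplectic_group \<omega>" and T: "represents T S" "represents T' S'"
  shows "intertwines A S S' \<longleftrightarrow> T' = tensor_map A T"
proof -
  obtain B where B: "\<And>x. A (B x) = x"
    using symplectic_group_inverse[OF A] by metis
  have l: "lower_indices \<omega> (tensor_map A T) (A X) (A Y) (A Z) = \<omega> (A (S X Y)) (A Z)" for X Y Z
    using T(1) by (simp add: lower_indices_tensor_map[OF A] symplectic_groupD[OF A] represents_def)
  have r: "lower_indices \<omega> T' (A X) (A Y) (A Z) = \<omega> (S' (A X) (A Y)) (A Z)" for X Y Z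
    using T(2) by (simp add: represents_def)
  show ?thesis
  proof
    assume "intertwines A S S'"
    then have "lower_indices \<omega> T' (A X) (A Y) (A Z) = lower_indices \<omega> (tensor_map A T) (A X) (A Y) (A Z)" for X Y Z
      by (simp add: l r intertwines_def)
    then show "T' = tensor_map A T"
      by (intro lower_indices_inject) (metis B)
  next
    assume "T' = tensor_map A T"
    then have "\<omega> (S' (A X) (A Y)) (A Z) = \<omega> (A (S X Y)) (A Z)" for X Y Z
      using l r by simp
    then show "intertwines A S S'"
      unfolding intertwines_def by (metis B form_eqI)
  qed
qed

lemma sym3_isotropic_represents:
  assumes U: "subspace U" "isotropic \<omega> U" and T: "T \<in> sym3 U"
  obtains S where "abelian_tensor S" "represents T S"
proof -
  \<comment> \<open>Vanishing of \<open>S x (S y z)\<close> is not linear in \<open>S\<close> and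
    does not pass through span induction. \<open>R\<close> replaces it by linear conditions that
    imply it: values in \<open>U\<close>, and \<open>U\<close> in the kernel of each
    \<open>S x\<close>.\<close>
  define R where "R S \<longleftrightarrow> prolongation_tensor S \<and> (\<forall>x y. S x y \<in> U) \<and> (\<forall>x. \<forall>u\<in>U. S x u = 0)"
    for S :: "'a \<Rightarrow>\<^sub>L 'a \<Rightarrow>\<^sub>L 'a"
  have "\<exists>S. R S \<and> represents T S"
    using T unfolding sym3_def
  proof (induction rule: span_induct)
    case base
    show ?case
    proof (intro subspaceI)
      show "0 \<in> {T. \<exists>S. R S \<and> represents T S}"
        using U(1) by (auto simp: R_def prolongation_tensor_def represents_def lower_indices_linear
            form_simps subspace_0 blinfun.zero_left intro!: exI[of _ 0])
    next
      fix T T'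
      assume "T \<in> {T. \<exists>S. R S \<and> represents T S}" "T' \<in> {T. \<exists>S. R S \<and> represents T S}"
      then obtain S S' where "R S" "represents T S" "R S'" "represents T' S'"
        by blast
      then show "T + T' \<in> {T. \<exists>S. R S \<and> represents T S}"
        using U(1) by (auto simp: R_def prolongation_tensor_def represents_def lower_indices_linear
            form_simps subspace_add blinfun.add_left intro!: exI[of _ "S + S'"])
    next
      fix T and c :: real
      assume "T \<in> {T. \<exists>S. R S \<and> represents T S}"
      then obtain S where "R S" "represents T S"
        by blast
      then show "c *\<^sub>R T \<in> {T. \<exists>S. R S \<and> represents T S}"
        using U(1) by (auto simp: R_def prolongation_tensor_def represents_def lower_indices_linear
            form_simps subspace_scale blinfun.scaleR_left intro!: exI[of _ "c *\<^sub>R S"])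
    qed
  next
    case (step T)
    then obtain u v w where T: "T = sym_prod u v w" and uvw: "u \<in> U" "v \<in> U" "w \<in> U"
      by blast
    \<comment> \<open>\<open>E u v w\<close> is the bilinear map attached to the tensor product of
      \<open>u\<close>, \<open>v\<close>, \<open>w\<close>. The two signs from
      \<open>flat u X = - \<omega> u X\<close> and \<open>flat v Y = - \<omega> v Y\<close>
      cancel.\<close>
    define E :: "'a \<Rightarrow> 'a \<Rightarrow> 'a \<Rightarrow> 'a \<Rightarrow>\<^sub>L 'a \<Rightarrow>\<^sub>L 'a" where
      "E u v w = blinfun_scaleR_left (blinfun_scaleR_left w o\<^sub>L flat v) o\<^sub>L flat u" for u v w
    have E: "E u v w X Y = (\<omega> u X * \<omega> v Y) *\<^sub>R w" for u v w X Y
      by (simp add: E_def blinfun.scaleR_left blinfun.minus_left form_skew[of X u] form_skew[of Y v])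
    define S where "S = (1 / 6) *\<^sub>R (E u v w + E u w v + E v u w + E v w u + E w u v + E w v u)"
    have S: "S X Y = (1 / 6) *\<^sub>R ((\<omega> u X * \<omega> v Y) *\<^sub>R w + (\<omega> u X * \<omega> w Y) *\<^sub>R v + (\<omega> v X * \<omega> u Y) *\<^sub>R w +
        (\<omega> v X * \<omega> w Y) *\<^sub>R u + (\<omega> w X * \<omega> u Y) *\<^sub>R v + (\<omega> w X * \<omega> v Y) *\<^sub>R u)" for X Y
      by (simp add: S_def E blinfun.add_left blinfun.scaleR_left)
    have "represents T S"
      by (simp add: represents_def T lower_indices_sym_prod S form_simps)
    moreover have "R S"
      unfolding R_def prolongation_tensor_def
    proof (intro conjI allI ballI)
      show "S x y = S y x" for x y
        by (simp add: S mult.commute add_ac)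
      show "\<omega> (S x y) z = - \<omega> y (S x z)" for x y z
        using form_skew[of y u] form_skew[of y v] form_skew[of y w]
        by (simp add: S form_simps algebra_simps)
      show "S x y \<in> U" for x y
        unfolding S using U(1) uvw by (intro subspace_scale subspace_add)
      \<comment> \<open>Every summand contains a factor pairing \<open>u'\<close> with one of
        \<open>u\<close>, \<open>v\<close>, \<open>w\<close>, which vanishes as \<open>U\<close> is
        isotropic.\<close>
      show "S x u' = 0" if "u' \<in> U" for x u'
        using U(2) uvw that by (simp add: S isotropic_def)
    qed
    ultimately show ?case
      by blast
  qed
  then obtain S where "R S" "represents T S"
    by blast
  moreover from this have "abelian_tensor S"
    unfolding R_def abelian_tensor_def by blast
  ultimately show thesis
    using that by blast
qed

text \<open>Skewness moves one operator across \<omega>, producing a composite of two, which is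
  zero.\<close>

lemma abelian_tensor_image_isotropic:
  assumes "abelian_tensor S"
  shows "isotropic \<omega> {S X Y | X Y. True}"
  using abelian_tensorD[OF assms] by (auto simp: isotropic_def form_simps)

text \<open>Every orbit arising from a group meets \<open>S^3 U\<close>. This makes the class map
  nonempty-valued, as both its injectivity and its range require.\<close>

lemma lagrangian_representative:
  assumes "lagrangian \<omega> U" and "H \<in> abelian_simply_transitive_groups \<omega>"
  obtains g where "g \<in> symplectic_group \<omega>" "tensor_map g (S_tensor \<omega> H) \<in> sym3 U"
proof -
  obtain S where S: "abelian_tensor S" "H = aff_group S"
    using abelian_simply_transitive_group_cases[OF assms(2)] by metis
  obtain L where L: "lagrangian \<omega> L" "{S X Y | X Y. True} \<subseteq> L"
    using isotropic_subset_lagrangian[OF abelian_tensor_image_isotropic[OF S(1)]] by metis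
  obtain g where g: "g \<in> symplectic_group \<omega>" "\<And>x. x \<in> L \<Longrightarrow> blinfun_apply g x \<in> U"
    using symplectic_group_transitive_lagrangian[OF L(1) assms(1)] by metis
  have "prolongation_tensor S" and "S X Y \<in> L" for X Y
    using S(1) L(2) by (auto simp: abelian_tensor_def)
  then obtain T where T: "T \<in> sym3 L" "represents T S"
    using represents_exists[OF _ lagrangianD(1)[OF L(1)]] by metis
  have "S_tensor \<omega> H = T"
    using represents_unique S_tensor_aff_group[OF S(1)] T(2) S(2) by blast
  moreover have "tensor_map g T \<in> sym3 U"
    using T(1) unfolding sym3_def
  proof (induction rule: span_induct)
    case base
    show ?case
      by (intro subspaceI)
        (auto simp: tensor_map_linear span_zero span_add span_scale)
  next
    case (step T)
    then obtain u v w where "T = sym_prod u v w" "u \<in> L" "v \<in> L" "w \<in> L"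
      by blast
    then show ?case
      using g(2) by (intro span_base) (auto simp: tensor_map_sym_prod)
  qed
  ultimately show thesis
    using that g(1) by blast
qed

section \<open>The correspondence\<close>

lemma sp_orbit_refl: "T \<in> sp_orbit \<omega> T"
  unfolding sp_orbit_def by (rule image_eqI[OF _ symplectic_group_id]) (simp add: tensor_map_id)

lemma sp_orbit_sym:
  assumes "T' \<in> sp_orbit \<omega> T"
  shows "T \<in> sp_orbit \<omega> T'"
proof -
  obtain g where g: "g \<in> symplectic_group \<omega>" "T' = tensor_map g T"
    using assms unfolding sp_orbit_def by blast
  obtain h where h: "h \<in> symplectic_group \<omega>" "h o\<^sub>L g = id_blinfun"
    using symplectic_group_inverse[OF g(1)] by metis
  then show ?thesis
    unfolding sp_orbit_def g(2) by (intro image_eqI[OF _ h(1)]) (simp add: tensor_map_compose tensor_map_id)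
qed

lemma sp_orbit_trans:
  assumes "T' \<in> sp_orbit \<omega> T" and "T'' \<in> sp_orbit \<omega> T'"
  shows "T'' \<in> sp_orbit \<omega> T"
  using assms symplectic_group_compose unfolding sp_orbit_def by (force simp: tensor_map_compose)

lemma sp_orbit_eq: "T' \<in> sp_orbit \<omega> T \<Longrightarrow> sp_orbit \<omega> T' = sp_orbit \<omega> T"
  using sp_orbit_sym sp_orbit_trans by blast

lemma aff_conjugate_iff_sp_orbit:
  assumes "H \<in> abelian_simply_transitive_groups \<omega>" and "K \<in> abelian_simply_transitive_groups \<omega>"
  shows "aff_conjugate \<omega> H K \<longleftrightarrow> S_tensor \<omega> K \<in> sp_orbit \<omega> (S_tensor \<omega> H)"
proof -
  obtain S where S: "abelian_tensor S" "H = aff_group S"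
    using abelian_simply_transitive_group_cases[OF assms(1)] by metis
  obtain S' where S': "abelian_tensor S'" "K = aff_group S'"
    using abelian_simply_transitive_group_cases[OF assms(2)] by metis
  show ?thesis
    using intertwines_iff_tensor_map[OF _ S_tensor_aff_group[OF S(1)] S_tensor_aff_group[OF S'(1)]]
    unfolding S(2) S'(2) aff_conjugate_iff[OF S(1)] sp_orbit_def by blast
qed

text \<open>Conjugacy is the pullback of the orbit relation along \<open>S_tensor\<close>, so its
  equivalence properties are inherited from orbits.\<close>

lemma equiv_conjugacy_rel: "equiv (abelian_simply_transitive_groups \<omega>) (conjugacy_rel \<omega>)"
proof -
  have "conjugacy_rel \<omega> = {(H, K). H \<in> abelian_simply_transitive_groups \<omega> \<and>
      K \<in> abelian_simply_transitive_groups \<omega> \<and> S_tensor \<omega> K \<in> sp_orbit \<omega> (S_tensor \<omega> H)}"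
    unfolding conjugacy_rel_def using aff_conjugate_iff_sp_orbit by blast
  then show ?thesis
    by (auto intro!: equivI refl_onI symI transI intro: sp_orbit_refl sp_orbit_sym sp_orbit_trans)
qed

lemma equiv_sp_equivalence_rel: "equiv (sym3 U) (sp_equivalence_rel \<omega> U)"
  unfolding sp_equivalence_rel_def
  by (auto intro!: equivI refl_onI symI transI intro: sp_orbit_refl sp_orbit_sym sp_orbit_trans)

lemma abelian_simply_transitive_group_exists:
  assumes "lagrangian \<omega> U" and "T \<in> sym3 U"
  obtains H where "H \<in> abelian_simply_transitive_groups \<omega>" "S_tensor \<omega> H = T"
proof -
  have "subspace U" "isotropic \<omega> U"
    using assms(1) by (auto simp: lagrangian_def)
  then obtain S where "abelian_tensor S" "represents T S"
    using sym3_isotropic_represents[OF _ _ assms(2)] by metis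
  then show thesis
    using that[OF aff_group_in_groups] represents_unique S_tensor_aff_group by blast
qed

end

theorem theorem1:
  fixes \<omega> :: "'a::euclidean_space \<Rightarrow> 'a \<Rightarrow> real" and U :: "'a set" and n :: nat
  assumes "symplectic_form \<omega>" and "DIM('a) = 2 * n" and "lagrangian \<omega> U"
  shows "equiv (abelian_simply_transitive_groups \<omega>) (conjugacy_rel \<omega>) \<and>
    equiv (sym3 U) (sp_equivalence_rel \<omega> U) \<and>
    (\<exists>f. bij_betw f (abelian_simply_transitive_groups \<omega> // conjugacy_rel \<omega>)
                    (sym3 U // sp_equivalence_rel \<omega> U) \<and>
         (\<forall>H \<in> abelian_simply_transitive_groups \<omega>.
            f (conjugacy_rel \<omega> `` {H}) = sp_orbit \<omega> (S_tensor \<omega> H) \<inter> sym3 U))"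
proof -
  interpret symplectic_space \<omega>
    by unfold_locales (rule assms(1))
  let ?A = "abelian_simply_transitive_groups \<omega>" and ?r = "conjugacy_rel \<omega>" and ?s = "sp_equivalence_rel \<omega> U"
  \<comment> \<open>Taking the union over the whole class avoids a choice of representative; all
    members give the same orbit.\<close>
  define f where "f C = (\<Union>H\<in>C. sp_orbit \<omega> (S_tensor \<omega> H)) \<inter> sym3 U" for C
  have r_iff: "(H, K) \<in> ?r \<longleftrightarrow> S_tensor \<omega> K \<in> sp_orbit \<omega> (S_tensor \<omega> H)" if "H \<in> ?A" "K \<in> ?A" for H K
    using that aff_conjugate_iff_sp_orbit[OF that] by (simp add: conjugacy_rel_def)
  have s_class: "?s `` {T} = sp_orbit \<omega> T \<inter> sym3 U" if "T \<in> sym3 U" for T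
    using that by (auto simp: sp_equivalence_rel_def)
  have f_class: "f (?r `` {H}) = sp_orbit \<omega> (S_tensor \<omega> H) \<inter> sym3 U" if H: "H \<in> ?A" for H
  proof -
    have "(H, H) \<in> ?r"
      by (simp add: r_iff[OF H H] sp_orbit_refl)
    moreover have "sp_orbit \<omega> (S_tensor \<omega> K) = sp_orbit \<omega> (S_tensor \<omega> H)" if "(H, K) \<in> ?r" for K
    proof (rule sp_orbit_eq)
      have "K \<in> ?A"
        using that by (simp add: conjugacy_rel_def)
      then show "S_tensor \<omega> K \<in> sp_orbit \<omega> (S_tensor \<omega> H)"
        using r_iff[OF H] that by blast
    qed
    ultimately show ?thesis
      unfolding f_def by blast
  qed
  have "inj_on f (?A // ?r)"
  proof (rule inj_onI)
    fix C D assume "C \<in> ?A // ?r" "D \<in> ?A // ?r" and eq: "f C = f D"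
    then obtain H K where HK: "H \<in> ?A" "C = ?r `` {H}" "K \<in> ?A" "D = ?r `` {K}"
      by (auto elim!: quotientE)
    \<comment> \<open>The common value of \<open>f\<close> is nonempty, and a tensor in it lies in
      both orbits; hence the orbits coincide.\<close>
    obtain g where "g \<in> symplectic_group \<omega>" "tensor_map g (S_tensor \<omega> H) \<in> sym3 U"
      using lagrangian_representative[OF assms(3) HK(1)] by metis
    then obtain T where "T \<in> f C"
      unfolding HK(2) f_class[OF HK(1)] sp_orbit_def by blast
    with eq have "T \<in> sp_orbit \<omega> (S_tensor \<omega> H)" "T \<in> sp_orbit \<omega> (S_tensor \<omega> K)"
      using f_class HK by auto
    then have "(H, K) \<in> ?r"
      unfolding r_iff[OF HK(1,3)] using sp_orbit_sym sp_orbit_trans by blast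
    then show "C = D"
      unfolding HK(2,4) by (rule equiv_class_eq[OF equiv_conjugacy_rel])
  qed
  moreover have "f ` (?A // ?r) = sym3 U // ?s"
  proof (intro subset_antisym subsetI)
    fix D assume "D \<in> f ` (?A // ?r)"
    then obtain H where H: "H \<in> ?A" "D = f (?r `` {H})"
      by (auto elim!: quotientE)
    obtain g where g: "g \<in> symplectic_group \<omega>" "tensor_map g (S_tensor \<omega> H) \<in> sym3 U"
      using lagrangian_representative[OF assms(3) H(1)] by metis
    have "tensor_map g (S_tensor \<omega> H) \<in> sp_orbit \<omega> (S_tensor \<omega> H)"
      using g(1) by (simp add: sp_orbit_def)
    \<comment> \<open>The part of the orbit inside \<open>S^3 U\<close> is one full equivalence
      class, that of the representative moved into \<open>S^3 U\<close>.\<close>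
    then have "D = ?s `` {tensor_map g (S_tensor \<omega> H)}"
      by (simp add: H(2) f_class[OF H(1)] s_class[OF g(2)] sp_orbit_eq)
    then show "D \<in> sym3 U // ?s"
      using g(2) by (simp add: quotientI)
  next
    fix D assume "D \<in> sym3 U // ?s"
    then obtain T where T: "T \<in> sym3 U" "D = ?s `` {T}"
      by (auto elim!: quotientE)
    obtain H where H: "H \<in> ?A" "S_tensor \<omega> H = T"
      using abelian_simply_transitive_group_exists[OF assms(3) T(1)] by metis
    have "D = f (?r `` {H})"
      by (simp add: f_class[OF H(1)] H(2) T(2) s_class[OF T(1)])
    then show "D \<in> f ` (?A // ?r)"
      using H(1) by (simp add: quotientI)
  qed
  ultimately show ?thesis
    using f_class equiv_conjugacy_rel equiv_sp_equivalence_rel unfolding bij_betw_def by blast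
qed

end
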